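(* Let $p$ be prime, $n\ge2$, and $G$ a profinite group. Write $\bar G=G/T^{\mathbb{U}_{n-1}}(G)$ and $\pi\colon G\to\bar G$ for the projection. Then: (a) there is a perfect bilinear map $T^{\mathbb{U}_{n-1}}(G)/T^{\mathbb{U}_n}(G)\times H^2(\bar G)_{n\text{-Massey},G}\to\mathbb{Z}/p$; (b) there is an exact sequence $0\to H^2(\bar G)_{n\text{-Massey},G}\to H^2(\bar G)\xrightarrow{\inf}H^2(G/T^{\mathbb{U}_n}(G))$.
   Context: For profinite groups $\mathbb{U}$ and $G$, $T^{\mathbb{U}}(G)$ denotes the intersection of the kernels of all continuous homomorphisms $G\to\mathbb{U}$. $\mathbb{U}_n=\mathbb{U}_n(\mathbb{Z}/p)$ is the group of unipotent upper-triangular $(n+1)\times(n+1)$ matrices over $\mathbb{Z}/p$, $\mathbb{Z}/p$ embeds centrally via $r\mapsto I+rE_{1,n+1}$, and $\bar{\mathbb{U}}_n=\mathbb{U}_n/(\mathbb{Z}/p)$, giving a central extension $0\to\mathbb{Z}/p\to\mathbb{U}_n\xrightarrow{\lambda}\bar{\mathbb{U}}_n\to1$ with class $\alpha_n\in H^2(\bar{\mathbb{U}}_n,\mathbb{Z}/p)$. Cohomology $H^i(\cdot)=H^i(\cdot,\mathbb{Z}/p)$ with trivial action. $H^2(\bar G)_{n\text{-Massey},G}$ is the subgroup of $H^2(\bar G)$ generated by the pullbacks $\bar\rho^*(\alpha_n)$ for continuous homomorphisms $\bar\rho\colon\bar G\to\bar{\mathbb{U}}_n$ for which there is a continuous $\rho\colon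 G\to\mathbb{U}_n$ with $\lambda\circ\rho=\bar\rho\circ\pi$. A bilinear map is perfect if both induced maps to Pontrjagin duals are isomorphisms. *)

theory Defs
  imports "HOL-Analysis.Analysis" "HOL-Algebra.Algebra"
begin

definition profinite_group :: "('g, 'b) monoid_scheme \<Rightarrow> 'g topology \<Rightarrow> bool" where
  "profinite_group G \<tau> \<longleftrightarrow> group G \<and> topspace \<tau> = carrier G
     \<and> continuous_map (prod_topology \<tau> \<tau>) \<tau> (\<lambda>(x, y). x \<otimes>\<^bsub>G\<^esub> y)
     \<and> continuous_map \<tau> \<tau> (\<lambda>x. inv\<^bsub>G\<^esub> x)
     \<and> compact_space \<tau> \<and> Hausdorff_space \<tau>
     \<and> (\<forall>x\<in>topspace \<tau>. connected_component_of_set \<tau> x = {x})"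

definition qtop :: "'a topology \<Rightarrow> ('a \<Rightarrow> 'c) \<Rightarrow> 'c topology" where
  "qtop \<tau> q = topology (\<lambda>V. V \<subseteq> q ` topspace \<tau> \<and> openin \<tau> (topspace \<tau> \<inter> q -` V))"

definition chom :: "('a, 'b) monoid_scheme \<Rightarrow> 'a topology \<Rightarrow> ('c, 'd) monoid_scheme \<Rightarrow> 'c topology
     \<Rightarrow> ('a \<Rightarrow> 'c) set" where
  "chom G \<tau> U \<sigma> = {\<rho>. \<rho> \<in> hom G U \<and> continuous_map \<tau> \<sigma> \<rho>}"

definition TU :: "('a, 'b) monoid_scheme \<Rightarrow> 'a topology \<Rightarrow> ('c, 'd) monoid_scheme \<Rightarrow> 'c topology \<Rightarrow> 'a set" where
  "TU G \<tau> U \<sigma> = carrier G \<inter> (\<Inter>\<rho>\<in>chom G \<tau> U \<sigma>. kernel G U \<rho>)"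

definition Zp :: "nat \<Rightarrow> int monoid" where
  "Zp p = \<lparr>carrier = {0..<int p}, mult = (\<lambda>a b. (a + b) mod int p), one = 0\<rparr>"

definition dualZp :: "('a, 'b) monoid_scheme \<Rightarrow> nat \<Rightarrow> ('a \<Rightarrow> int) monoid" where
  "dualZp M p = \<lparr>carrier = {\<xi>. \<xi> \<in> hom M (Zp p) \<and> \<xi> \<in> extensional (carrier M)},
                 mult = (\<lambda>\<xi> \<psi>. \<lambda>m\<in>carrier M. (\<xi> m + \<psi> m) mod int p),
                 one = (\<lambda>m\<in>carrier M. 0)\<rparr>"

definition cdualZp :: "('a, 'b) monoid_scheme \<Rightarrow> 'a topology \<Rightarrow> nat \<Rightarrow> ('a \<Rightarrow> int) monoid" where
  "cdualZp A \<tau> p = \<lparr>carrier = {\<xi>. \<xi> \<in> chom A \<tau> (Zp p) (discrete_topology {0..<int p})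
                                    \<and> \<xi> \<in> extensional (carrier A)},
                   mult = (\<lambda>\<xi> \<psi>. \<lambda>a\<in>carrier A. (\<xi> a + \<psi> a) mod int p),
                   one = (\<lambda>a\<in>carrier A. 0)\<rparr>"

text \<open>Perfect bilinear map A \<times> M \<rightarrow> Z/p, A profinite (topology \<tau>A), M discrete.\<close>
definition perfect_pairing :: "('a, 'b) monoid_scheme \<Rightarrow> 'a topology \<Rightarrow> ('c, 'd) monoid_scheme
     \<Rightarrow> nat \<Rightarrow> ('a \<Rightarrow> 'c \<Rightarrow> int) \<Rightarrow> bool" where
  "perfect_pairing A \<tau>A M p B \<longleftrightarrow>
     (\<forall>m\<in>carrier M. (\<lambda>a. B a m) \<in> chom A \<tau>A (Zp p) (discrete_topology {0..<int p}))
   \<and> (\<forall>a\<in>carrier A. (\<lambda>m. B a m) \<in> hom M (Zp p))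
   \<and> (\<lambda>a. \<lambda>m\<in>carrier M. B a m) \<in> iso A (dualZp M p)
   \<and> (\<lambda>m. \<lambda>a\<in>carrier A. B a m) \<in> iso M (cdualZp A \<tau>A p)"

definition Z2 :: "('a, 'b) monoid_scheme \<Rightarrow> 'a topology \<Rightarrow> nat \<Rightarrow> ('a \<Rightarrow> 'a \<Rightarrow> int) set" where
  "Z2 G \<tau> p = {f. continuous_map (prod_topology \<tau> \<tau>) (discrete_topology {0..<int p}) (\<lambda>(x, y). f x y)
      \<and> (\<forall>x y. (x \<notin> carrier G \<or> y \<notin> carrier G) \<longrightarrow> f x y = 0)
      \<and> (\<forall>x\<in>carrier G. \<forall>y\<in>carrier G. \<forall>z\<in>carrier G.
           (f y z - f (x \<otimes>\<^bsub>G\<^esub> y) z + f x (y \<otimes>\<^bsub>G\<^esub> z) - f x y) mod int p = 0)}"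

definition B2 :: "('a, 'b) monoid_scheme \<Rightarrow> 'a topology \<Rightarrow> nat \<Rightarrow> ('a \<Rightarrow> 'a \<Rightarrow> int) set" where
  "B2 G \<tau> p = {(\<lambda>x y. if x \<in> carrier G \<and> y \<in> carrier G
                        then (h y - h (x \<otimes>\<^bsub>G\<^esub> y) + h x) mod int p else 0) | h.
                continuous_map \<tau> (discrete_topology {0..<int p}) h}"

definition Z2grp :: "('a, 'b) monoid_scheme \<Rightarrow> 'a topology \<Rightarrow> nat \<Rightarrow> ('a \<Rightarrow> 'a \<Rightarrow> int) monoid" where
  "Z2grp G \<tau> p = \<lparr>carrier = Z2 G \<tau> p, mult = (\<lambda>f g x y. (f x y + g x y) mod int p),
                   one = (\<lambda>x y. 0)\<rparr>"

definition H2 :: "('a, 'b) monoid_scheme \<Rightarrow> 'a topology \<Rightarrow> nat \<Rightarrow> ('a \<Rightarrow> 'a \<Rightarrow> int) set monoid" where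
  "H2 G \<tau> p = Z2grp G \<tau> p Mod B2 G \<tau> p"

definition pull2 :: "('a, 'b) monoid_scheme \<Rightarrow> ('a \<Rightarrow> 'c) \<Rightarrow> ('c \<Rightarrow> 'c \<Rightarrow> int) \<Rightarrow> 'a \<Rightarrow> 'a \<Rightarrow> int" where
  "pull2 K \<phi> f = (\<lambda>x y. if x \<in> carrier K \<and> y \<in> carrier K then f (\<phi> x) (\<phi> y) else 0)"

definition H2_pull :: "('a, 'b) monoid_scheme \<Rightarrow> 'a topology \<Rightarrow> nat \<Rightarrow> ('a \<Rightarrow> 'c)
     \<Rightarrow> ('c \<Rightarrow> 'c \<Rightarrow> int) set \<Rightarrow> ('a \<Rightarrow> 'a \<Rightarrow> int) set" where
  "H2_pull K \<tau> p \<phi> c = B2 K \<tau> p #>\<^bsub>Z2grp K \<tau> p\<^esub> pull2 K \<phi> (SOME f. f \<in> c)"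

definition Unip :: "nat \<Rightarrow> nat \<Rightarrow> (nat \<Rightarrow> nat \<Rightarrow> int) monoid" where
  "Unip p n = \<lparr>carrier = {A. (\<forall>i j. A i j \<in> {0..<int p})
                  \<and> (\<forall>i j. i \<notin> {1..n+1} \<or> j \<notin> {1..n+1} \<longrightarrow> A i j = 0)
                  \<and> (\<forall>i\<in>{1..n+1}. A i i = 1)
                  \<and> (\<forall>i j. j < i \<longrightarrow> A i j = 0)},
             mult = (\<lambda>A B i j. if i \<in> {1..n+1} \<and> j \<in> {1..n+1}
                                then (\<Sum>k\<in>{1..n+1}. A i k * B k j) mod int p else 0),
             one = (\<lambda>i j. if i = j \<and> i \<in> {1..n+1} then 1 else 0)\<rparr>"

definition Zemb :: "nat \<Rightarrow> int \<Rightarrow> nat \<Rightarrow> nat \<Rightarrow> int" where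
  "Zemb n r = (\<lambda>i j. if i = j \<and> i \<in> {1..n+1} then 1 else if i = 1 \<and> j = n+1 then r else 0)"

definition Zc :: "nat \<Rightarrow> nat \<Rightarrow> (nat \<Rightarrow> nat \<Rightarrow> int) set" where
  "Zc p n = Zemb n ` {0..<int p}"

definition Ubar :: "nat \<Rightarrow> nat \<Rightarrow> (nat \<Rightarrow> nat \<Rightarrow> int) set monoid" where
  "Ubar p n = Unip p n Mod Zc p n"

definition lam :: "nat \<Rightarrow> nat \<Rightarrow> (nat \<Rightarrow> nat \<Rightarrow> int) \<Rightarrow> (nat \<Rightarrow> nat \<Rightarrow> int) set" where
  "lam p n A = Zc p n #>\<^bsub>Unip p n\<^esub> A"

text \<open>Cocycle of the central extension w.r.t. a set-theoretic section s:
 (x,y) \<mapsto> the (1,n+1)-entry of s(x)s(y)s(xy)^{-1} \<in> Z/p.\<close>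
definition alpha_cocycle :: "nat \<Rightarrow> nat \<Rightarrow> (nat \<Rightarrow> nat \<Rightarrow> int) set \<Rightarrow> (nat \<Rightarrow> nat \<Rightarrow> int) set \<Rightarrow> int" where
  "alpha_cocycle p n x y =
     (if x \<in> carrier (Ubar p n) \<and> y \<in> carrier (Ubar p n) then
        (let s = (\<lambda>c. SOME A. A \<in> c) in
          ((s x \<otimes>\<^bsub>Unip p n\<^esub> s y) \<otimes>\<^bsub>Unip p n\<^esub> inv\<^bsub>Unip p n\<^esub> (s (x \<otimes>\<^bsub>Ubar p n\<^esub> y))) 1 (n+1))
      else 0)"

definition alpha :: "nat \<Rightarrow> nat \<Rightarrow> ((nat \<Rightarrow> nat \<Rightarrow> int) set \<Rightarrow> (nat \<Rightarrow> nat \<Rightarrow> int) set \<Rightarrow> int) set" where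
  "alpha p n = B2 (Ubar p n) (discrete_topology (carrier (Ubar p n))) p
                 #>\<^bsub>Z2grp (Ubar p n) (discrete_topology (carrier (Ubar p n))) p\<^esub> alpha_cocycle p n"

definition Tn :: "('g, 'b) monoid_scheme \<Rightarrow> 'g topology \<Rightarrow> nat \<Rightarrow> nat \<Rightarrow> 'g set" where
  "Tn G \<tau> p n = TU G \<tau> (Unip p n) (discrete_topology (carrier (Unip p n)))"

definition Gq :: "('g, 'b) monoid_scheme \<Rightarrow> 'g topology \<Rightarrow> nat \<Rightarrow> nat \<Rightarrow> 'g set monoid" where
  "Gq G \<tau> p k = G Mod Tn G \<tau> p k"

definition \<tau>q :: "('g, 'b) monoid_scheme \<Rightarrow> 'g topology \<Rightarrow> nat \<Rightarrow> nat \<Rightarrow> 'g set topology" where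
  "\<tau>q G \<tau> p k = qtop \<tau> (\<lambda>x. Tn G \<tau> p k #>\<^bsub>G\<^esub> x)"

definition Massey :: "('g, 'b) monoid_scheme \<Rightarrow> 'g topology \<Rightarrow> nat \<Rightarrow> nat \<Rightarrow> ('g set \<Rightarrow> 'g set \<Rightarrow> int) set set" where
  "Massey G \<tau> p n = generate (H2 (Gq G \<tau> p (n-1)) (\<tau>q G \<tau> p (n-1)) p)
     {H2_pull (Gq G \<tau> p (n-1)) (\<tau>q G \<tau> p (n-1)) p \<rho>b (alpha p n) | \<rho>b.
        \<rho>b \<in> chom (Gq G \<tau> p (n-1)) (\<tau>q G \<tau> p (n-1)) (Ubar p n) (discrete_topology (carrier (Ubar p n)))
      \<and> (\<exists>\<rho>\<in>chom G \<tau> (Unip p n) (discrete_topology (carrier (Unip p n))).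
            \<forall>x\<in>carrier G. lam p n (\<rho> x) = \<rho>b (Tn G \<tau> p (n-1) #>\<^bsub>G\<^esub> x))}"

text \<open>Inflation H^2(G/T^{U_{n-1}}) \<rightarrow> H^2(G/T^{U_n}), induced by G/T^{U_n} \<rightarrow> G/T^{U_{n-1}}.\<close>
definition infl :: "('g, 'b) monoid_scheme \<Rightarrow> 'g topology \<Rightarrow> nat \<Rightarrow> nat
     \<Rightarrow> ('g set \<Rightarrow> 'g set \<Rightarrow> int) set \<Rightarrow> ('g set \<Rightarrow> 'g set \<Rightarrow> int) set" where
  "infl G \<tau> p n = H2_pull (Gq G \<tau> p n) (\<tau>q G \<tau> p n) p (\<lambda>C. Tn G \<tau> p (n-1) <#>\<^bsub>G\<^esub> C)"

definition Tquot :: "('g, 'b) monoid_scheme \<Rightarrow> 'g topology \<Rightarrow> nat \<Rightarrow> nat \<Rightarrow> 'g set monoid" where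
  "Tquot G \<tau> p n = (G\<lparr>carrier := Tn G \<tau> p (n-1)\<rparr>) Mod Tn G \<tau> p n"

definition \<tau>Tquot :: "('g, 'b) monoid_scheme \<Rightarrow> 'g topology \<Rightarrow> nat \<Rightarrow> nat \<Rightarrow> 'g set topology" where
  "\<tau>Tquot G \<tau> p n = qtop (subtopology \<tau> (Tn G \<tau> p (n-1))) (\<lambda>x. Tn G \<tau> p n #>\<^bsub>G\<^esub> x)"

end

(* Write N and M for the intersections attached to U_{n-1} and U_n. A class [f] dies in H^2(G/M)
   iff the inflation of f to G is the coboundary of some M-invariant h. Since continuous characters
   of G vanish on N (Z/p embeds into U_{n-1}), the restriction of h - h(1) to N depends only on [f]:
   it is a character of N/M, and it determines [f], because h descends to G/N as soon as it is trivial.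
   This pairs N/M with ker(inf). For the class of a homomorphism rho from G to U_n, the splitting h is
   read off the upper right corner of rho, so the character is minus that corner; hence the Massey
   classes already separate the points of N/M. Linear algebra over F_p and the compactness of N/M
   turn this separation into perfectness and into the equality of ker(inf) with the Massey subgroup. *)
theory Submission
  imports Defs "HOL-Number_Theory.Cong"
begin

section \<open>Pairings modulo a prime\<close>

text \<open>The group N/M is central in G/M and receives no nonzero restriction of a character of G.
  In the five-term sequence, transgression therefore identifies the characters of N/M with the
  kernel of inflation. The proof builds the inverse of this map, up to sign, from functions on G, so
  that no spectral sequence and no action on H^1 has to be set up. The condition n >= 2 guarantees
  that the corner of U_{n-1} lies off the diagonal, which gives Z/p a place to embed. The matrices
  contribute one structural fact: if both diagonal blocks of size n of a matrix in U_n are trivial,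
  only its corner entry is left. Hence on N every rho amounts to a single residue. The pairing is
  set up on the whole kernel of inflation and not on the Massey subgroup. A subgroup of the kernel
  that separates the points of N/M cannot be proper, so one pairing yields both the perfectness and
  the exactness.\<close>

lemma cong_linear_combination:
  assumes "[a = a'] (mod (m::int))" "[b = b'] (mod m)" "[c = c'] (mod m)" "[d = d'] (mod m)"
    and "z - z' = q * (a - a') + r * (b - b') + s * (c - c') + t * (d - d')"
  shows "[z = z'] (mod m)"
  using assms unfolding cong_iff_dvd_diff by simp

lemma cong_int_reduced: "[a = b] (mod int p) \<Longrightarrow> a \<in> {0..<int p} \<Longrightarrow> b \<in> {0..<int p} \<Longrightarrow> a = b"
  by (auto intro: cong_less_imp_eq_int)

lemma cong_0_reduced: "[a = 0] (mod int p) \<Longrightarrow> a \<in> {0..<int p} \<Longrightarrow> a = 0"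
  by (auto simp: cong_0_iff dest: zdvd_imp_le)

text \<open>Indexed form of the finite intersection property. The factor \<open>topspace T\<close>
  keeps the empty family meaningful, since an empty intersection is \<open>UNIV\<close>.\<close>

lemma compact_space_finite_intersection:
  assumes "compact_space T" "\<And>i. i \<in> I \<Longrightarrow> closedin T (C i)"
    and "\<And>F. finite F \<Longrightarrow> F \<subseteq> I \<Longrightarrow> topspace T \<inter> (\<Inter>i\<in>F. C i) \<noteq> {}"
  shows "topspace T \<inter> (\<Inter>i\<in>I. C i) \<noteq> {}"
proof -
  have "\<Inter>(insert (topspace T) (C ` I)) \<noteq> {}"
  proof (rule assms(1)[unfolded compact_space_fip, rule_format], intro conjI ballI allI impI)
    fix D assume "D \<in> insert (topspace T) (C ` I)"
    then show "closedin T D" using assms(2) by auto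
  next
    fix \<F> assume F: "finite \<F> \<and> \<F> \<subseteq> insert (topspace T) (C ` I)"
    then have "finite (\<F> - {topspace T})" "\<F> - {topspace T} \<subseteq> C ` I" by auto
    then obtain J where J: "J \<subseteq> I" "finite J" "\<F> - {topspace T} = C ` J"
      by (meson finite_subset_image)
    have "topspace T \<inter> (\<Inter>i\<in>J. C i) \<subseteq> \<Inter>\<F>"
    proof (intro subsetI InterI)
      fix x D assume x: "x \<in> topspace T \<inter> (\<Inter>i\<in>J. C i)" and "D \<in> \<F>"
      then have "D = topspace T \<or> D \<in> C ` J" using J(3) by blast
      then show "x \<in> D" using x by blast
    qed
    with assms(3)[OF J(2,1)] show "\<Inter>\<F> \<noteq> {}" by auto
  qed
  then show ?thesis by auto
qed

text \<open>Bilinearity is a congruence, so that unreduced functions such as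
  \<open>\<theta> a - int c * B a \<phi>\<close> can be handled as characters. Scalars of F_p act as
  natural powers of group elements, which spares the construction of a vector space.\<close>

locale mod_pairing = A: group A + M: group M
  for A :: "('a, 'b) monoid_scheme" and M :: "('c, 'd) monoid_scheme" +
  fixes p :: nat and B :: "'a \<Rightarrow> 'c \<Rightarrow> int"
  assumes prime_p: "Factorial_Ring.prime p"
    and mult_left: "\<lbrakk>a \<in> carrier A; a' \<in> carrier A; m \<in> carrier M\<rbrakk>
      \<Longrightarrow> [B (a \<otimes>\<^bsub>A\<^esub> a') m = B a m + B a' m] (mod int p)"
    and mult_right: "\<lbrakk>a \<in> carrier A; m \<in> carrier M; m' \<in> carrier M\<rbrakk>
      \<Longrightarrow> [B a (m \<otimes>\<^bsub>M\<^esub> m') = B a m + B a m'] (mod int p)"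
begin

lemma one_left: "m \<in> carrier M \<Longrightarrow> [B \<one>\<^bsub>A\<^esub> m = 0] (mod int p)"
  using mult_left[of "\<one>\<^bsub>A\<^esub>" "\<one>\<^bsub>A\<^esub>" m] by (simp add: cong_iff_dvd_diff)

lemma one_right: "a \<in> carrier A \<Longrightarrow> [B a \<one>\<^bsub>M\<^esub> = 0] (mod int p)"
  using mult_right[of a "\<one>\<^bsub>M\<^esub>" "\<one>\<^bsub>M\<^esub>"] by (simp add: cong_iff_dvd_diff)

lemma pow_right: "a \<in> carrier A \<Longrightarrow> m \<in> carrier M
  \<Longrightarrow> [B a (m [^]\<^bsub>M\<^esub> (k::nat)) = int k * B a m] (mod int p)"
proof (induction k)
  case (Suc k)
  have "[B a (m [^]\<^bsub>M\<^esub> k \<otimes>\<^bsub>M\<^esub> m) = B a (m [^]\<^bsub>M\<^esub> k) + B a m] (mod int p)"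
    using Suc by (intro mult_right) auto
  also have "[B a (m [^]\<^bsub>M\<^esub> k) + B a m = int k * B a m + B a m] (mod int p)"
    using Suc by (intro cong_add) auto
  finally show ?case by (simp add: algebra_simps)
qed (simp add: one_right)

lemma character_pow:
  assumes "\<And>a a'. a \<in> carrier A \<Longrightarrow> a' \<in> carrier A \<Longrightarrow> [\<theta> (a \<otimes>\<^bsub>A\<^esub> a') = \<theta> a + \<theta> a'] (mod int p)"
    and a: "a \<in> carrier A"
  shows "[\<theta> (a [^]\<^bsub>A\<^esub> (k::nat)) = int k * \<theta> a] (mod int p)"
proof (induction k)
  case 0
  then show ?case using assms(1)[of "\<one>\<^bsub>A\<^esub>" "\<one>\<^bsub>A\<^esub>"] by (simp add: cong_iff_dvd_diff)
next
  case (Suc k)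
  have "[\<theta> (a [^]\<^bsub>A\<^esub> k \<otimes>\<^bsub>A\<^esub> a) = \<theta> (a [^]\<^bsub>A\<^esub> k) + \<theta> a] (mod int p)"
    using a by (intro assms(1)) auto
  also have "[\<theta> (a [^]\<^bsub>A\<^esub> k) + \<theta> a = int k * \<theta> a + \<theta> a] (mod int p)"
    using Suc by (intro cong_add) auto
  finally show ?case by (simp add: algebra_simps)
qed

lemma mod_inverse_exists: "\<not> [b = 0] (mod int p) \<Longrightarrow> \<exists>u. [b * u = 1] (mod int p)"
  by (metis cong_0_iff cong_solve_coprime_int coprime_commute prime_imp_coprime prime_nat_int_transfer prime_p)

lemma nat_mod_cong: "[int (nat (x mod int p)) = x] (mod int p)"
  using prime_p prime_gt_0_nat[of p] by (simp add: cong_def)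

text \<open>The F_p version of the fact that a functional vanishing on the common kernel of finitely
  many functionals is a combination of them. The induction removes one \<open>\<phi>\<close> at a
  time by subtracting a multiple of it from \<open>\<theta>\<close>. Closure of \<open>H\<close>
  under products suffices to form combinations, because multiples are powers.\<close>

lemma character_in_span:
  assumes "finite F" "F \<subseteq> H" and H: "H \<subseteq> carrier M" "\<one>\<^bsub>M\<^esub> \<in> H"
    "\<And>m m'. m \<in> H \<Longrightarrow> m' \<in> H \<Longrightarrow> m \<otimes>\<^bsub>M\<^esub> m' \<in> H"
    and "\<And>a a'. a \<in> carrier A \<Longrightarrow> a' \<in> carrier A \<Longrightarrow> [\<theta> (a \<otimes>\<^bsub>A\<^esub> a') = \<theta> a + \<theta> a'] (mod int p)"
    and "\<And>a. a \<in> carrier A \<Longrightarrow> (\<And>m. m \<in> F \<Longrightarrow> [B a m = 0] (mod int p)) \<Longrightarrow> [\<theta> a = 0] (mod int p)"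
  shows "\<exists>m\<in>H. \<forall>a\<in>carrier A. [\<theta> a = B a m] (mod int p)"
  using assms(1,2,6,7)
proof (induction F arbitrary: \<theta> rule: finite_induct)
  case empty
  have "[\<theta> a = B a \<one>\<^bsub>M\<^esub>] (mod int p)" if "a \<in> carrier A" for a
    using empty(3)[OF that] one_right[OF that] by (meson cong_sym cong_trans empty_iff)
  then show ?case using H by blast
next
  case (insert \<phi> F)
  have \<phi>: "\<phi> \<in> H" "\<phi> \<in> carrier M" and FM: "\<And>m. m \<in> F \<Longrightarrow> m \<in> carrier M" using insert H by auto
  show ?case
  proof (cases "\<forall>a\<in>carrier A. (\<forall>m\<in>F. [B a m = 0] (mod int p)) \<longrightarrow> [B a \<phi> = 0] (mod int p)")
    case True
    show ?thesis
    proof (rule insert.IH)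
      fix a assume a: "a \<in> carrier A" "\<And>m. m \<in> F \<Longrightarrow> [B a m = 0] (mod int p)"
      show "[\<theta> a = 0] (mod int p)"
        by (rule insert.prems(3)[OF a(1)]) (use a True in blast)
    qed (use insert.prems in auto)
  next
    case False
    then obtain b where b: "b \<in> carrier A" "\<And>m. m \<in> F \<Longrightarrow> [B b m = 0] (mod int p)"
      and "\<not> [B b \<phi> = 0] (mod int p)" by blast
    then obtain u where u: "[B b \<phi> * u = 1] (mod int p)" using mod_inverse_exists by blast
    \<comment> \<open>The value of \<open>c\<close> is forced by \<open>\<theta>' b = 0\<close>: it
      is the quotient of \<open>\<theta> b\<close> by \<open>B b \<phi>\<close>.\<close>
    define c where "c = nat ((\<theta> b * u) mod int p)"
    have c: "[int c = \<theta> b * u] (mod int p)" unfolding c_def by (rule nat_mod_cong)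
    define \<theta>' where "\<theta>' a = \<theta> a - int c * B a \<phi>" for a
    have kill: "[\<theta>' x = 0] (mod int p)" if x: "x \<in> carrier A" "\<And>m. m \<in> F \<Longrightarrow> [B x m = 0] (mod int p)" for x
    proof -
      \<comment> \<open>Multiplying \<open>x\<close> by this power of \<open>b\<close> cancels its
        value at \<open>\<phi>\<close> and leaves its values on \<open>F\<close> at zero. The
        hypothesis on \<open>\<theta>\<close> thus applies to the product.\<close>
      define k where "k = nat ((- B x \<phi> * u) mod int p)"
      have k: "[int k = - B x \<phi> * u] (mod int p)" unfolding k_def by (rule nat_mod_cong)
      let ?y = "x \<otimes>\<^bsub>A\<^esub> b [^]\<^bsub>A\<^esub> k"
      have By: "[B ?y m = B x m + int k * B b m] (mod int p)" if "m \<in> carrier M" for m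
      proof -
        have "[B ?y m = B x m + B (b [^]\<^bsub>A\<^esub> k) m] (mod int p)" using x b that by (intro mult_left) auto
        moreover have "[B (b [^]\<^bsub>A\<^esub> k) m = int k * B b m] (mod int p)"
          by (rule character_pow[where \<theta> = "\<lambda>a. B a m"]) (use b that mult_left in auto)
        ultimately show ?thesis by (meson cong_add_lcancel cong_trans)
      qed
      have "[B ?y m = 0] (mod int p)" if "m \<in> insert \<phi> F" for m
      proof (cases "m = \<phi>")
        case True
        have "[B ?y \<phi> = B x \<phi> + int k * B b \<phi>] (mod int p)" using By \<phi> by blast
        \<comment> \<open>Here and below the coefficients form a certificate: the difference of the
          two sides is written as a combination of differences of known congruences. A slot filled
          with \<open>cong_refl\<close> gets coefficient 0.\<close>
        then have "[B ?y \<phi> = 0] (mod int p)"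
          by (rule cong_linear_combination[OF _ k u cong_refl,
                where q = 1 and r = "B b \<phi>" and s = "- B x \<phi>" and t = 0]) (simp add: algebra_simps)
        with True show ?thesis by simp
      next
        case False
        then have "[B ?y m = B x m + int k * B b m] (mod int p)" "[B x m = 0] (mod int p)" "[B b m = 0] (mod int p)"
          using By FM that x b by auto
        then show ?thesis
          by (rule cong_linear_combination[OF _ _ _ cong_refl, where q = 1 and r = 1 and s = "int k" and t = 0]) simp
      qed
      then have "[\<theta> ?y = 0] (mod int p)" using insert.prems(3)[of ?y] x b by auto
      moreover have "[\<theta> ?y = \<theta> x + \<theta> (b [^]\<^bsub>A\<^esub> k)] (mod int p)" using x b by (intro insert.prems(2)) auto
      moreover have "[\<theta> (b [^]\<^bsub>A\<^esub> k) = int k * \<theta> b] (mod int p)"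
        by (rule character_pow) (use insert.prems(2) b in auto)
      ultimately have x0: "[\<theta> x + int k * \<theta> b = 0] (mod int p)"
        by (rule cong_linear_combination[OF _ _ _ cong_refl, where q = 1 and r = "-1" and s = "-1" and t = 0]) simp
      show ?thesis unfolding \<theta>'_def
        by (rule cong_linear_combination[OF x0 k c cong_refl,
              where q = 1 and r = "- \<theta> b" and s = "- B x \<phi>" and t = 0]) (simp add: algebra_simps)
    qed
    have "\<exists>m\<in>H. \<forall>a\<in>carrier A. [\<theta>' a = B a m] (mod int p)"
    proof (rule insert.IH)
      fix a a' assume aa: "a \<in> carrier A" "a' \<in> carrier A"
      have "[\<theta> (a \<otimes>\<^bsub>A\<^esub> a') = \<theta> a + \<theta> a'] (mod int p)" "[B (a \<otimes>\<^bsub>A\<^esub> a') \<phi> = B a \<phi> + B a' \<phi>] (mod int p)"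
        using insert.prems(2) mult_left aa \<phi> by auto
      then show "[\<theta>' (a \<otimes>\<^bsub>A\<^esub> a') = \<theta>' a + \<theta>' a'] (mod int p)"
        unfolding \<theta>'_def
        by (rule cong_linear_combination[OF _ _ cong_refl cong_refl, where q = 1 and r = "- int c" and s = 0 and t = 0])
          (simp add: algebra_simps)
    qed (use kill insert.prems in auto)
    then obtain m where m: "m \<in> H" "\<And>a. a \<in> carrier A \<Longrightarrow> [\<theta>' a = B a m] (mod int p)" by blast
    have pw: "\<phi> [^]\<^bsub>M\<^esub> c \<in> H" by (induction c) (use H \<phi> in auto)
    have "[\<theta> a = B a (m \<otimes>\<^bsub>M\<^esub> \<phi> [^]\<^bsub>M\<^esub> c)] (mod int p)" if a: "a \<in> carrier A" for a
    proof -
      have "[B a (m \<otimes>\<^bsub>M\<^esub> \<phi> [^]\<^bsub>M\<^esub> c) = B a m + B a (\<phi> [^]\<^bsub>M\<^esub> c)] (mod int p)"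
        using m pw H a by (intro mult_right) auto
      moreover have "[B a (\<phi> [^]\<^bsub>M\<^esub> c) = int c * B a \<phi>] (mod int p)" using a \<phi> by (intro pow_right)
      ultimately show ?thesis
        by (rule cong_linear_combination[OF m(2)[OF a, unfolded \<theta>'_def] _ _ cong_refl,
              where q = 1 and r = "-1" and s = "-1" and t = 0]) simp
    qed
    then show ?thesis using H(3)[OF m(1) pw] by blast
  qed
qed

end

section \<open>Duality between a compact group and a discrete group of characters\<close>

locale compact_pairing = mod_pairing +
  fixes \<sigma> :: "'a topology"
  assumes compact: "compact_space \<sigma>" and topspace: "topspace \<sigma> = carrier A"
    and continuous_left: "m \<in> carrier M \<Longrightarrow> continuous_map \<sigma> (discrete_topology {0..<int p}) (\<lambda>a. B a m)"
    and nondegenerate_right: "\<lbrakk>m \<in> carrier M; m' \<in> carrier M; \<And>a. a \<in> carrier A \<Longrightarrow> B a m = B a m'\<rbrakk> \<Longrightarrow> m = m'"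
begin

lemma B_range: "a \<in> carrier A \<Longrightarrow> m \<in> carrier M \<Longrightarrow> B a m \<in> {0..<int p}"
  using continuous_left topspace by (fastforce simp: continuous_map_def Pi_iff)

lemma B_mult_right: "a \<in> carrier A \<Longrightarrow> m \<in> carrier M \<Longrightarrow> m' \<in> carrier M
  \<Longrightarrow> B a (m \<otimes>\<^bsub>M\<^esub> m') = (B a m + B a m') mod int p"
  using mult_right[of a m m'] B_range[of a "m \<otimes>\<^bsub>M\<^esub> m'"] by (simp add: cong_def)

lemma B_mult_left: "a \<in> carrier A \<Longrightarrow> a' \<in> carrier A \<Longrightarrow> m \<in> carrier M
  \<Longrightarrow> B (a \<otimes>\<^bsub>A\<^esub> a') m = (B a m + B a' m) mod int p"
  using mult_left[of a a' m] B_range[of "a \<otimes>\<^bsub>A\<^esub> a'" m] by (simp add: cong_def)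

text \<open>By compactness, finitely many members of \<open>H\<close> already have a common kernel
  on which \<open>\<theta>\<close> vanishes; the rest is \<open>character_in_span\<close>.\<close>

lemma continuous_character_in_span:
  assumes H: "H \<subseteq> carrier M" "\<one>\<^bsub>M\<^esub> \<in> H" "\<And>m m'. m \<in> H \<Longrightarrow> m' \<in> H \<Longrightarrow> m \<otimes>\<^bsub>M\<^esub> m' \<in> H"
    and sep: "\<And>a. a \<in> carrier A \<Longrightarrow> (\<And>m. m \<in> H \<Longrightarrow> B a m = 0) \<Longrightarrow> a = \<one>\<^bsub>A\<^esub>"
    and \<theta>: "continuous_map \<sigma> (discrete_topology {0..<int p}) \<theta>"
      "\<And>a a'. a \<in> carrier A \<Longrightarrow> a' \<in> carrier A \<Longrightarrow> [\<theta> (a \<otimes>\<^bsub>A\<^esub> a') = \<theta> a + \<theta> a'] (mod int p)"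
  shows "\<exists>m\<in>H. \<forall>a\<in>carrier A. \<theta> a = B a m"
proof -
  have \<theta>R: "\<theta> a \<in> {0..<int p}" if "a \<in> carrier A" for a
    using \<theta>(1) that topspace by (fastforce simp: continuous_map_def Pi_iff)
  have \<theta>1: "\<theta> \<one>\<^bsub>A\<^esub> = 0"
    using \<theta>(2)[of "\<one>\<^bsub>A\<^esub>" "\<one>\<^bsub>A\<^esub>"] \<theta>R[of "\<one>\<^bsub>A\<^esub>"]
    by (intro cong_0_reduced) (auto simp: cong_iff_dvd_diff)
  have p0: "0 < int p" using prime_p prime_gt_0_nat by simp
  have "\<exists>F. finite F \<and> F \<subseteq> H \<and> (\<forall>a\<in>carrier A. (\<forall>m\<in>F. B a m = 0) \<longrightarrow> \<theta> a = 0)"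
  proof (rule ccontr)
    assume neg: "\<not> ?thesis"
    define C where "C i = (case i of None \<Rightarrow> {a \<in> topspace \<sigma>. \<theta> a \<in> {1..<int p}} | Some m \<Rightarrow> {a \<in> topspace \<sigma>. B a m \<in> {0}})" for i
    have "topspace \<sigma> \<inter> (\<Inter>i\<in>insert None (Some ` H). C i) \<noteq> {}"
    proof (rule compact_space_finite_intersection[OF compact])
      fix i assume i: "i \<in> insert None (Some ` H)"
      have "closedin \<sigma> {a \<in> topspace \<sigma>. \<theta> a \<in> {1..<int p}}"
        by (rule closedin_continuous_map_preimage[OF \<theta>(1)]) auto
      moreover have "closedin \<sigma> {a \<in> topspace \<sigma>. B a m \<in> {0}}" if "m \<in> H" for m
        by (rule closedin_continuous_map_preimage[OF continuous_left]) (use that H p0 in auto)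
      ultimately show "closedin \<sigma> (C i)" using i by (auto simp: C_def)
    next
      fix F assume F: "finite F" "F \<subseteq> insert None (Some ` H)"
      let ?F = "{m. Some m \<in> F}"
      have "finite ?F" by (rule finite_subset[of _ "the ` F"]) (use F in \<open>auto intro: rev_image_eqI\<close>)
      moreover have "?F \<subseteq> H" using F by auto
      ultimately obtain a where a: "a \<in> carrier A" "\<And>m. Some m \<in> F \<Longrightarrow> B a m = 0" "\<theta> a \<noteq> 0"
        using neg by blast
      have "\<theta> a \<in> {1..<int p}" using \<theta>R[OF a(1)] a(3) by auto
      then have "a \<in> C i" if "i \<in> F" for i
        using that a topspace by (auto simp: C_def split: option.splits)
      then show "topspace \<sigma> \<inter> (\<Inter>i\<in>F. C i) \<noteq> {}" using a topspace by auto
    qed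
    then obtain a where a: "a \<in> topspace \<sigma>" "a \<in> C None" "\<And>m. m \<in> H \<Longrightarrow> a \<in> C (Some m)" by auto
    then have "a = \<one>\<^bsub>A\<^esub>" using sep[of a] topspace by (auto simp: C_def)
    with a(2) \<theta>1 show False by (auto simp: C_def)
  qed
  then obtain F where F: "finite F" "F \<subseteq> H" "\<And>a. a \<in> carrier A \<Longrightarrow> (\<forall>m\<in>F. B a m = 0) \<Longrightarrow> \<theta> a = 0" by blast
  have "\<exists>m\<in>H. \<forall>a\<in>carrier A. [\<theta> a = B a m] (mod int p)"
  proof (rule character_in_span[where \<theta> = \<theta>, OF F(1,2) H \<theta>(2)])
    fix a assume a: "a \<in> carrier A" "\<And>m. m \<in> F \<Longrightarrow> [B a m = 0] (mod int p)"
    have "B a m = 0" if "m \<in> F" for m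
      using cong_0_reduced[OF a(2)[OF that] B_range[OF a(1)]] that F H by blast
    then show "[\<theta> a = 0] (mod int p)" using F(3)[OF a(1)] by simp
  qed auto
  then show ?thesis using cong_int_reduced[OF _ \<theta>R B_range] H by (meson subsetD)
qed

text \<open>Every \<open>m\<close> is itself a continuous character of \<open>A\<close>, hence
  represented inside \<open>H\<close>, and nondegeneracy identifies it with its representative. This
  is what upgrades the inclusion of the Massey subgroup in the kernel of inflation to an
  equality.\<close>

lemma separating_subset_eq:
  assumes "H \<subseteq> carrier M" "\<one>\<^bsub>M\<^esub> \<in> H" "\<And>m m'. m \<in> H \<Longrightarrow> m' \<in> H \<Longrightarrow> m \<otimes>\<^bsub>M\<^esub> m' \<in> H"
    and "\<And>a. a \<in> carrier A \<Longrightarrow> (\<And>m. m \<in> H \<Longrightarrow> B a m = 0) \<Longrightarrow> a = \<one>\<^bsub>A\<^esub>"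
  shows "H = carrier M"
proof
  show "carrier M \<subseteq> H"
  proof
    fix m assume m: "m \<in> carrier M"
    have "\<exists>m'\<in>H. \<forall>a\<in>carrier A. B a m = B a m'"
      by (rule continuous_character_in_span[OF assms continuous_left[OF m] mult_left[OF _ _ m]])
    then show "m \<in> H" using nondegenerate_right[OF m] assms(1) by (metis subsetD)
  qed
qed (rule assms(1))

text \<open>Solves finitely many equations \<open>B a m = \<xi> m\<close> one at a time: either the new \<open>m\<close> is a combination
  of the old ones, or some \<open>b\<close> killed by the old ones can be used to adjust the value at \<open>m\<close>.\<close>
lemma finite_evaluation:
  assumes "finite F" "F \<subseteq> carrier M"
    and \<xi>: "\<And>m m'. m \<in> carrier M \<Longrightarrow> m' \<in> carrier M \<Longrightarrow> [\<xi> (m \<otimes>\<^bsub>M\<^esub> m') = \<xi> m + \<xi> m'] (mod int p)"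
  shows "\<exists>a\<in>carrier A. \<forall>m\<in>F. [B a m = \<xi> m] (mod int p)"
  using assms(1,2)
proof (induction F rule: finite_induct)
  case empty
  then show ?case using A.one_closed by blast
next
  case (insert n F)
  then obtain a where a: "a \<in> carrier A" "\<And>m. m \<in> F \<Longrightarrow> [B a m = \<xi> m] (mod int p)" by blast
  have n: "n \<in> carrier M" and FM: "\<And>m. m \<in> F \<Longrightarrow> m \<in> carrier M" using insert by auto
  show ?case
  proof (cases "\<forall>x\<in>carrier A. (\<forall>m\<in>F. [B x m = 0] (mod int p)) \<longrightarrow> [B x n = 0] (mod int p)")
    case True
    \<comment> \<open>The equations solved by \<open>a\<close> are closed under products, so they
      may serve as the span. The combination of \<open>F\<close> that induces the same character as
      \<open>n\<close> then lies in \<open>?H\<close>, and nondegeneracy identifies it with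
      \<open>n\<close>.\<close>
    let ?H = "{m \<in> carrier M. [B a m = \<xi> m] (mod int p)}"
    have \<xi>1: "[\<xi> \<one>\<^bsub>M\<^esub> = 0] (mod int p)" using \<xi>[of "\<one>\<^bsub>M\<^esub>" "\<one>\<^bsub>M\<^esub>"] by (simp add: cong_iff_dvd_diff)
    have "\<exists>m\<in>?H. \<forall>x\<in>carrier A. [B x n = B x m] (mod int p)"
    proof (rule character_in_span[OF insert.hyps(1)])
      show "\<one>\<^bsub>M\<^esub> \<in> ?H" using \<xi>1 one_right[OF a(1)] by (auto intro: cong_trans cong_sym)
      fix m m' assume mm: "m \<in> ?H" "m' \<in> ?H"
      then have "[B a (m \<otimes>\<^bsub>M\<^esub> m') = B a m + B a m'] (mod int p)" "[\<xi> (m \<otimes>\<^bsub>M\<^esub> m') = \<xi> m + \<xi> m'] (mod int p)"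
        "[B a m + B a m' = \<xi> m + \<xi> m'] (mod int p)"
        using mult_right[OF a(1)] \<xi> by (auto intro: cong_add)
      then have "[B a (m \<otimes>\<^bsub>M\<^esub> m') = \<xi> (m \<otimes>\<^bsub>M\<^esub> m')] (mod int p)" by (meson cong_trans cong_sym)
      with mm show "m \<otimes>\<^bsub>M\<^esub> m' \<in> ?H" by auto
    qed (use FM a n mult_left True in auto)
    then obtain m where m: "m \<in> ?H" "\<And>x. x \<in> carrier A \<Longrightarrow> [B x n = B x m] (mod int p)" by blast
    have "n = m"
    proof (rule nondegenerate_right[OF n])
      fix x assume x: "x \<in> carrier A"
      show "B x n = B x m" by (rule cong_int_reduced[OF m(2)[OF x]]) (use B_range x n m in auto)
    qed (use m in auto)
    then show ?thesis using m a by auto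
  next
    case False
    then obtain b where b: "b \<in> carrier A" "\<And>m. m \<in> F \<Longrightarrow> [B b m = 0] (mod int p)"
      and "\<not> [B b n = 0] (mod int p)" by blast
    then obtain u where u: "[B b n * u = 1] (mod int p)" using mod_inverse_exists by blast
    \<comment> \<open>\<open>k\<close> solves \<open>B a n + k * B b n = \<xi> n\<close> modulo
      \<open>p\<close>; the equations for \<open>F\<close> are not disturbed because
      \<open>b\<close> is killed there.\<close>
    define k where "k = nat (((\<xi> n - B a n) * u) mod int p)"
    have k: "[int k = (\<xi> n - B a n) * u] (mod int p)" unfolding k_def by (rule nat_mod_cong)
    let ?y = "a \<otimes>\<^bsub>A\<^esub> b [^]\<^bsub>A\<^esub> k"
    have By: "[B ?y m = B a m + int k * B b m] (mod int p)" if "m \<in> carrier M" for m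
    proof -
      have "[B ?y m = B a m + B (b [^]\<^bsub>A\<^esub> k) m] (mod int p)" using a b that by (intro mult_left) auto
      moreover have "[B (b [^]\<^bsub>A\<^esub> k) m = int k * B b m] (mod int p)"
        by (rule character_pow[where \<theta> = "\<lambda>a. B a m"]) (use b that mult_left in auto)
      ultimately show ?thesis by (meson cong_add_lcancel cong_trans)
    qed
    have "[B ?y m = \<xi> m] (mod int p)" if "m \<in> insert n F" for m
    proof (cases "m = n")
      case True
      have "[B ?y n = B a n + int k * B b n] (mod int p)" using By n by blast
      then have "[B ?y n = \<xi> n] (mod int p)"
        by (rule cong_linear_combination[OF _ k u cong_refl,
              where q = 1 and r = "B b n" and s = "\<xi> n - B a n" and t = 0]) (simp add: algebra_simps)
      with True show ?thesis by simp
    next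
      case False
      then have "[B ?y m = B a m + int k * B b m] (mod int p)" "[B a m = \<xi> m] (mod int p)" "[B b m = 0] (mod int p)"
        using By FM that a b by auto
      then show ?thesis
        by (rule cong_linear_combination[OF _ _ _ cong_refl, where q = 1 and r = 1 and s = "int k" and t = 0]) simp
    qed
    then show ?thesis using a b by (meson A.m_closed A.nat_pow_closed)
  qed
qed

text \<open>Each half of the two isomorphisms has its own source. For the map out of
  \<open>A\<close>, separation gives injectivity, and finite solvability with compactness gives
  surjectivity. For the map out of \<open>M\<close>, these are \<open>nondegenerate_right\<close>
  and \<open>continuous_character_in_span\<close> with \<open>H\<close> the whole of
  \<open>M\<close>.\<close>

lemma perfect_pairing:
  assumes sep: "\<And>a. a \<in> carrier A \<Longrightarrow> (\<And>m. m \<in> carrier M \<Longrightarrow> B a m = 0) \<Longrightarrow> a = \<one>\<^bsub>A\<^esub>"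
  shows "perfect_pairing A \<sigma> M p B"
  unfolding perfect_pairing_def
proof (intro conjI ballI)
  fix m assume m: "m \<in> carrier M"
  show "(\<lambda>a. B a m) \<in> chom A \<sigma> (Zp p) (discrete_topology {0..<int p})"
    using m B_range B_mult_left continuous_left by (auto simp: chom_def hom_def Zp_def)
next
  fix a assume a: "a \<in> carrier A"
  show "B a \<in> hom M (Zp p)" using a B_range B_mult_right by (auto simp: hom_def Zp_def)
next
  let ?L = "\<lambda>a. \<lambda>m\<in>carrier M. B a m"
  show "?L \<in> iso A (dualZp M p)"
  proof (rule isoI)
    show "?L \<in> hom A (dualZp M p)"
      using B_range B_mult_left B_mult_right
      by (auto simp: hom_def dualZp_def Zp_def intro!: restrict_ext)
    show "bij_betw ?L (carrier A) (carrier (dualZp M p))"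
      unfolding bij_betw_def
    proof
      show "inj_on ?L (carrier A)"
      proof (rule inj_onI)
        fix x y assume xy: "x \<in> carrier A" "y \<in> carrier A" "?L x = ?L y"
        have "x \<otimes>\<^bsub>A\<^esub> inv\<^bsub>A\<^esub> y = \<one>\<^bsub>A\<^esub>"
        proof (rule sep)
          fix m assume m: "m \<in> carrier M"
          have "B x m = B y m" using fun_cong[OF xy(3), of m] m by simp
          moreover have "[B (x \<otimes>\<^bsub>A\<^esub> inv\<^bsub>A\<^esub> y) m = B x m + B (inv\<^bsub>A\<^esub> y) m] (mod int p)"
            "[B (y \<otimes>\<^bsub>A\<^esub> inv\<^bsub>A\<^esub> y) m = B y m + B (inv\<^bsub>A\<^esub> y) m] (mod int p)"
            by (rule mult_left; use xy m in simp)+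
          moreover have "[B (y \<otimes>\<^bsub>A\<^esub> inv\<^bsub>A\<^esub> y) m = 0] (mod int p)" using xy m one_left by simp
          ultimately have "[B (x \<otimes>\<^bsub>A\<^esub> inv\<^bsub>A\<^esub> y) m = 0] (mod int p)"
            by (metis cong_trans cong_sym)
          then show "B (x \<otimes>\<^bsub>A\<^esub> inv\<^bsub>A\<^esub> y) m = 0"
            by (rule cong_0_reduced) (use B_range xy m in auto)
        qed (use xy in auto)
        then show "x = y" using xy
          by (metis A.inv_closed A.inv_equality A.inv_inv)
      qed
      have "\<xi> \<in> ?L ` carrier A" if x: "\<xi> \<in> carrier (dualZp M p)" for \<xi>
      proof -
        have \<xi>: "\<xi> m \<in> {0..<int p}" "[\<xi> (m \<otimes>\<^bsub>M\<^esub> m') = \<xi> m + \<xi> m'] (mod int p)" 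
          if "m \<in> carrier M" "m' \<in> carrier M" for m m'
          using x that by (auto simp: dualZp_def hom_def Zp_def cong_def)
        \<comment> \<open>The solution sets of the single equations are closed, and any finitely
          many of them meet by \<open>finite_evaluation\<close>. A point common to all of them is a
          preimage of \<open>\<xi>\<close>.\<close>
        have "topspace \<sigma> \<inter> (\<Inter>m\<in>carrier M. {a \<in> topspace \<sigma>. B a m \<in> {\<xi> m}}) \<noteq> {}"
        proof (rule compact_space_finite_intersection[OF compact])
          fix m assume m: "m \<in> carrier M"
          show "closedin \<sigma> {a \<in> topspace \<sigma>. B a m \<in> {\<xi> m}}"
            by (rule closedin_continuous_map_preimage[OF continuous_left[OF m]]) (use \<xi>(1)[OF m m] in auto)
        next
          fix F assume F: "finite F" "F \<subseteq> carrier M"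
          obtain a where a: "a \<in> carrier A" "\<And>m. m \<in> F \<Longrightarrow> [B a m = \<xi> m] (mod int p)"
            using finite_evaluation[OF F \<xi>(2)] by blast
          have "B a m = \<xi> m" if "m \<in> F" for m
            by (rule cong_int_reduced[OF a(2)[OF that]]) (use that F a B_range \<xi>(1) in blast)+
          then show "topspace \<sigma> \<inter> (\<Inter>m\<in>F. {a \<in> topspace \<sigma>. B a m \<in> {\<xi> m}}) \<noteq> {}"
            using a topspace by auto
        qed
        then obtain a where a: "a \<in> carrier A" "\<And>m. m \<in> carrier M \<Longrightarrow> B a m = \<xi> m"
          using topspace by auto
        have "\<xi> = ?L a"
          using x a by (intro extensionalityI[of \<xi> "carrier M"]) (auto simp: dualZp_def)
        then show ?thesis using a by blast
      qed
      moreover have "?L ` carrier A \<subseteq> carrier (dualZp M p)"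
        using B_range B_mult_right by (auto simp: hom_def dualZp_def Zp_def)
      ultimately show "?L ` carrier A = carrier (dualZp M p)" by blast
    qed
  qed
next
  let ?R = "\<lambda>m. \<lambda>a\<in>carrier A. B a m"
  have cont: "continuous_map \<sigma> (discrete_topology {0..<int p}) (?R m)" if "m \<in> carrier M" for m
    by (rule continuous_map_eq[OF continuous_left[OF that]]) (simp add: topspace)
  show "?R \<in> iso M (cdualZp A \<sigma> p)"
  proof (rule isoI)
    show "?R \<in> hom M (cdualZp A \<sigma> p)"
      using B_range B_mult_left B_mult_right cont
      by (auto simp: hom_def cdualZp_def Zp_def chom_def intro!: restrict_ext)
    show "bij_betw ?R (carrier M) (carrier (cdualZp A \<sigma> p))"
      unfolding bij_betw_def
    proof
      show "inj_on ?R (carrier M)"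
      proof (rule inj_onI)
        fix m m' assume mm: "m \<in> carrier M" "m' \<in> carrier M" "?R m = ?R m'"
        show "m = m'"
          by (rule nondegenerate_right[OF mm(1,2)]) (use fun_cong[OF mm(3)] in \<open>metis restrict_apply'\<close>)
      qed
      have "\<theta> \<in> ?R ` carrier M" if x: "\<theta> \<in> carrier (cdualZp A \<sigma> p)" for \<theta>
      proof -
        have "\<exists>m\<in>carrier M. \<forall>a\<in>carrier A. \<theta> a = B a m"
        proof (rule continuous_character_in_span)
          show "continuous_map \<sigma> (discrete_topology {0..<int p}) \<theta>" using x by (auto simp: cdualZp_def chom_def)
          show "[\<theta> (a \<otimes>\<^bsub>A\<^esub> a') = \<theta> a + \<theta> a'] (mod int p)" if "a \<in> carrier A" "a' \<in> carrier A" for a a'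
            using x that by (auto simp: cdualZp_def chom_def hom_def Zp_def cong_def)
        qed (use sep in auto)
        then obtain m where m: "m \<in> carrier M" "\<And>a. a \<in> carrier A \<Longrightarrow> \<theta> a = B a m" by blast
        have "\<theta> = ?R m"
          using x m by (intro extensionalityI[of \<theta> "carrier A"]) (auto simp: cdualZp_def)
        then show ?thesis using m by blast
      qed
      moreover have "?R ` carrier M \<subseteq> carrier (cdualZp A \<sigma> p)"
        using B_range B_mult_left cont by (auto simp: hom_def chom_def cdualZp_def Zp_def)
      ultimately show "?R ` carrier M = carrier (cdualZp A \<sigma> p)" by blast
    qed
  qed
qed

end

section \<open>Continuous cochains\<close>

text \<open>Any function on a discrete space is continuous, so \<open>F\<close> is first composed
  into \<open>UNIV\<close> and the target is cut down to \<open>R\<close> afterwards. In this way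
  the range condition concerns only pairs of values taken at a common point.\<close>

lemma continuous_map_discrete_binop:
  assumes f: "continuous_map \<tau> (discrete_topology S) f" and g: "continuous_map \<tau> (discrete_topology T) g"
    and "\<And>x. x \<in> topspace \<tau> \<Longrightarrow> F (f x) (g x) \<in> R"
  shows "continuous_map \<tau> (discrete_topology R) (\<lambda>x. F (f x) (g x))"
proof -
  have "continuous_map \<tau> (discrete_topology (S \<times> T)) (\<lambda>x. (f x, g x))"
    unfolding prod_topology_discrete_topology by (intro continuous_map_pairedI f g)
  moreover have "continuous_map (discrete_topology (S \<times> T)) (discrete_topology UNIV) (case_prod F)"
    by simp
  ultimately have "continuous_map \<tau> (discrete_topology UNIV) (case_prod F \<circ> (\<lambda>x. (f x, g x)))"
    by (rule continuous_map_compose)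
  then have "continuous_map \<tau> (subtopology (discrete_topology UNIV) R) (case_prod F \<circ> (\<lambda>x. (f x, g x)))"
    by (rule continuous_map_into_subtopology) (use assms(3) in auto)
  then show ?thesis by (simp add: o_def)
qed

lemma continuous_map_discrete_unop:
  assumes "continuous_map \<tau> (discrete_topology S) f" "\<And>x. x \<in> topspace \<tau> \<Longrightarrow> F (f x) \<in> R"
  shows "continuous_map \<tau> (discrete_topology R) (\<lambda>x. F (f x))"
  using continuous_map_discrete_binop[OF assms(1,1), of "\<lambda>a b. F a" R] assms(2) by simp

lemma cong_mod_alternating: "[a mod m - b mod m + c mod m - d mod m = a - b + c - (d::int)] (mod m)"
  by (intro cong_add cong_diff) simp_all

lemma mod_add_alternating:
  assumes "a + b = c - d + (e::int)"
  shows "(a mod m + b mod m) mod m = (c mod m - d mod m + e mod m) mod m"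
proof -
  have "[c mod m - d mod m + e mod m = c - d + e] (mod m)" by (intro cong_add cong_diff) simp_all
  then show ?thesis using assms by (simp add: cong_def mod_add_eq)
qed

locale topological_group = group K for K :: "('a, 'b) monoid_scheme" (structure) +
  fixes \<sigma> :: "'a topology"
  assumes topspace_eq: "topspace \<sigma> = carrier K"
    and mult_continuous: "continuous_map (prod_topology \<sigma> \<sigma>) \<sigma> (\<lambda>(x, y). x \<otimes> y)"

definition coboundary :: "('a, 'b) monoid_scheme \<Rightarrow> nat \<Rightarrow> ('a \<Rightarrow> int) \<Rightarrow> 'a \<Rightarrow> 'a \<Rightarrow> int" where
  "coboundary K p h = (\<lambda>x y. if x \<in> carrier K \<and> y \<in> carrier K
     then (h y - h (x \<otimes>\<^bsub>K\<^esub> y) + h x) mod int p else 0)"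

lemma B2_coboundary: "B2 K \<sigma> p = {coboundary K p h | h. continuous_map \<sigma> (discrete_topology {0..<int p}) h}"
  by (simp add: B2_def coboundary_def)

section \<open>Continuous 2-cocycles, coboundaries and H^2\<close>

locale cochains = topological_group + fixes p :: nat assumes p_pos: "0 < p"
begin

abbreviation "Z \<equiv> Z2grp K \<sigma> p"

lemma Z2D:
  assumes "f \<in> Z2 K \<sigma> p"
  shows "continuous_map (prod_topology \<sigma> \<sigma>) (discrete_topology {0..<int p}) (\<lambda>(x, y). f x y)"
    and "f x y \<in> {0..<int p}"
    and "x \<notin> carrier K \<or> y \<notin> carrier K \<Longrightarrow> f x y = 0"
    and "x \<in> carrier K \<Longrightarrow> y \<in> carrier K \<Longrightarrow> z \<in> carrier K
      \<Longrightarrow> [f y z - f (x \<otimes> y) z + f x (y \<otimes> z) - f x y = 0] (mod int p)"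
proof -
  show c: "continuous_map (prod_topology \<sigma> \<sigma>) (discrete_topology {0..<int p}) (\<lambda>(x, y). f x y)"
    using assms by (simp add: Z2_def)
  show z: "x \<notin> carrier K \<or> y \<notin> carrier K \<Longrightarrow> f x y = 0" for x y
    using assms by (auto simp: Z2_def)
  show "f x y \<in> {0..<int p}"
  proof (cases "x \<in> carrier K \<and> y \<in> carrier K")
    case True
    then show ?thesis using c by (fastforce simp: continuous_map_def Pi_iff topspace_eq)
  next
    case False
    then show ?thesis using z p_pos by auto
  qed
qed (use assms in \<open>auto simp: Z2_def cong_def\<close>)

lemma Z2I:
  assumes "continuous_map (prod_topology \<sigma> \<sigma>) (discrete_topology {0..<int p}) (\<lambda>(x, y). f x y)"
    and "\<And>x y. x \<notin> carrier K \<or> y \<notin> carrier K \<Longrightarrow> f x y = 0"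
    and "\<And>x y z. x \<in> carrier K \<Longrightarrow> y \<in> carrier K \<Longrightarrow> z \<in> carrier K
      \<Longrightarrow> [f y z - f (x \<otimes> y) z + f x (y \<otimes> z) - f x y = 0] (mod int p)"
  shows "f \<in> Z2 K \<sigma> p"
  using assms by (auto simp: Z2_def cong_def)

lemma Z2_ext:
  assumes "f \<in> Z2 K \<sigma> p" "g \<in> Z2 K \<sigma> p"
    and "\<And>x y. x \<in> carrier K \<Longrightarrow> y \<in> carrier K \<Longrightarrow> [f x y = g x y] (mod int p)"
  shows "f = g"
proof (intro ext)
  fix x y show "f x y = g x y"
    using cong_int_reduced[OF assms(3) Z2D(2)[OF assms(1)] Z2D(2)[OF assms(2)]]
      Z2D(3)[OF assms(1), of x y] Z2D(3)[OF assms(2), of x y]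
    by (cases "x \<in> carrier K \<and> y \<in> carrier K") auto
qed

lemma Z2_add:
  assumes f: "f \<in> Z2 K \<sigma> p" and g: "g \<in> Z2 K \<sigma> p"
  shows "(\<lambda>x y. (f x y + g x y) mod int p) \<in> Z2 K \<sigma> p"
proof (rule Z2I)
  show "continuous_map (prod_topology \<sigma> \<sigma>) (discrete_topology {0..<int p}) (\<lambda>(x, y). (f x y + g x y) mod int p)"
    using continuous_map_discrete_binop[OF Z2D(1)[OF f] Z2D(1)[OF g], of "\<lambda>a b. (a + b) mod int p" "{0..<int p}"] p_pos
    by (simp add: case_prod_unfold)
next
  fix x y z assume K: "x \<in> carrier K" "y \<in> carrier K" "z \<in> carrier K"
  have "[(f y z + g y z) - (f (x \<otimes> y) z + g (x \<otimes> y) z) + (f x (y \<otimes> z) + g x (y \<otimes> z)) - (f x y + g x y) = 0] (mod int p)"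
    by (rule cong_linear_combination[OF Z2D(4)[OF f K] Z2D(4)[OF g K] cong_refl cong_refl,
          where q = 1 and r = 1 and s = 0 and t = 0]) simp
  then show "[(f y z + g y z) mod int p - (f (x \<otimes> y) z + g (x \<otimes> y) z) mod int p
     + (f x (y \<otimes> z) + g x (y \<otimes> z)) mod int p - (f x y + g x y) mod int p = 0] (mod int p)"
    by (rule cong_trans[OF cong_mod_alternating])
qed (simp add: Z2D(3)[OF f] Z2D(3)[OF g])

lemma Z2_uminus:
  assumes f: "f \<in> Z2 K \<sigma> p"
  shows "(\<lambda>x y. (- f x y) mod int p) \<in> Z2 K \<sigma> p"
proof (rule Z2I)
  show "continuous_map (prod_topology \<sigma> \<sigma>) (discrete_topology {0..<int p}) (\<lambda>(x, y). (- f x y) mod int p)"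
    using continuous_map_discrete_unop[OF Z2D(1)[OF f], of "\<lambda>a. (- a) mod int p" "{0..<int p}"] p_pos
    by (simp add: case_prod_unfold)
next
  fix x y z assume K: "x \<in> carrier K" "y \<in> carrier K" "z \<in> carrier K"
  have "[- f y z - (- f (x \<otimes> y) z) + (- f x (y \<otimes> z)) - (- f x y) = 0] (mod int p)"
    by (rule cong_linear_combination[OF Z2D(4)[OF f K] cong_refl cong_refl cong_refl,
          where q = "-1" and r = 0 and s = 0 and t = 0]) simp
  then show "[(- f y z) mod int p - (- f (x \<otimes> y) z) mod int p
     + (- f x (y \<otimes> z)) mod int p - (- f x y) mod int p = 0] (mod int p)"
    by (rule cong_trans[OF cong_mod_alternating])
qed (simp add: Z2D(3)[OF f])

lemma Z2_zero: "(\<lambda>x y. 0) \<in> Z2 K \<sigma> p"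
proof (rule Z2I)
  show "continuous_map (prod_topology \<sigma> \<sigma>) (discrete_topology {0..<int p}) (\<lambda>(x, y). 0)"
    using p_pos by (simp add: case_prod_unfold)
qed auto

lemma carrier_Z: "carrier Z = Z2 K \<sigma> p"
  and mult_Z: "f \<otimes>\<^bsub>Z\<^esub> g = (\<lambda>x y. (f x y + g x y) mod int p)"
  and one_Z: "\<one>\<^bsub>Z\<^esub> = (\<lambda>x y. 0)"
  by (simp_all add: Z2grp_def)

lemma comm_group_Z: "comm_group Z"
proof (rule comm_groupI)
  fix f assume f: "f \<in> carrier Z"
  then show "\<one>\<^bsub>Z\<^esub> \<otimes>\<^bsub>Z\<^esub> f = f"
    using Z2D(2)[of f] by (auto simp: carrier_Z mult_Z one_Z intro!: ext)
  show "\<exists>g\<in>carrier Z. g \<otimes>\<^bsub>Z\<^esub> f = \<one>\<^bsub>Z\<^esub>"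
    using Z2_uminus f by (intro bexI[of _ "\<lambda>x y. (- f x y) mod int p"]) (auto simp: carrier_Z mult_Z one_Z mod_simps)
qed (auto simp: carrier_Z mult_Z one_Z Z2_add Z2_zero mod_simps ac_simps)

lemma continuous_translates:
  assumes h: "continuous_map \<sigma> (discrete_topology R) h"
  shows "continuous_map (prod_topology \<sigma> \<sigma>) (discrete_topology R) (\<lambda>(x, y). h x)"
    "continuous_map (prod_topology \<sigma> \<sigma>) (discrete_topology R) (\<lambda>(x, y). h y)"
    "continuous_map (prod_topology \<sigma> \<sigma>) (discrete_topology R) (\<lambda>(x, y). h (x \<otimes> y))"
  using continuous_map_compose[OF continuous_map_fst h, of \<sigma>] continuous_map_compose[OF continuous_map_snd h, of \<sigma>]
    continuous_map_compose[OF mult_continuous h]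
  by (simp_all add: o_def case_prod_unfold)

lemma coboundary_Z2:
  assumes h: "continuous_map \<sigma> (discrete_topology {0..<int p}) h"
  shows "coboundary K p h \<in> Z2 K \<sigma> p"
proof (rule Z2I)
  note c = continuous_translates[OF h]
  \<comment> \<open>The coboundary is assembled from two binary operations. The inner reduction
    keeps the intermediate function valued in residues and is absorbed by the outer one.\<close>
  have "continuous_map (prod_topology \<sigma> \<sigma>) (discrete_topology {0..<int p})
      (\<lambda>u. ((\<lambda>(x, y). h y) u + (\<lambda>u. ((\<lambda>(x, y). h x) u - (\<lambda>(x, y). h (x \<otimes> y)) u) mod int p) u) mod int p)"
    by (rule continuous_map_discrete_binop[where F = "\<lambda>a b. (a + b) mod int p", OF c(2)],
        rule continuous_map_discrete_binop[where F = "\<lambda>a b. (a - b) mod int p", OF c(1,3)]) (use p_pos in auto)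
  then show "continuous_map (prod_topology \<sigma> \<sigma>) (discrete_topology {0..<int p}) (\<lambda>(x, y). coboundary K p h x y)"
    by (rule continuous_map_eq) (auto simp: coboundary_def topspace_eq mod_simps algebra_simps)
next
  fix x y z assume K: "x \<in> carrier K" "y \<in> carrier K" "z \<in> carrier K"
  then show "[coboundary K p h y z - coboundary K p h (x \<otimes> y) z + coboundary K p h x (y \<otimes> z) - coboundary K p h x y = 0] (mod int p)"
    by (simp add: coboundary_def m_assoc cong_trans[OF cong_mod_alternating])
qed (auto simp: coboundary_def)

lemma subgroup_B2: "subgroup (B2 K \<sigma> p) Z"
proof -
  interpret Z: comm_group Z by (rule comm_group_Z)
  have [simp]: "(\<lambda>x. 0) \<in> topspace \<sigma> \<rightarrow> {0..<int p}" using p_pos by auto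
  show ?thesis
  proof (rule Z.subgroupI)
    show "B2 K \<sigma> p \<subseteq> carrier Z" using coboundary_Z2 by (auto simp: B2_coboundary carrier_Z)
    show "B2 K \<sigma> p \<noteq> {}" unfolding B2_coboundary using p_pos by (auto intro!: exI[of _ "\<lambda>x. 0"])
  next
    fix f assume "f \<in> B2 K \<sigma> p"
    then obtain h where h: "continuous_map \<sigma> (discrete_topology {0..<int p}) h" "f = coboundary K p h"
      by (auto simp: B2_coboundary)
    have c: "continuous_map \<sigma> (discrete_topology {0..<int p}) (\<lambda>x. (- h x) mod int p)"
      by (rule continuous_map_discrete_unop[OF h(1)]) (use p_pos in auto)
    have "inv\<^bsub>Z\<^esub> f = coboundary K p (\<lambda>x. (- h x) mod int p)"
      by (rule Z.inv_equality)
        (use coboundary_Z2[OF h(1)] coboundary_Z2[OF c] h in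
          \<open>auto simp: carrier_Z mult_Z one_Z coboundary_def mod_simps intro!: ext\<close>)
    then show "inv\<^bsub>Z\<^esub> f \<in> B2 K \<sigma> p" using c by (auto simp: B2_coboundary)
  next
    fix f g assume "f \<in> B2 K \<sigma> p" "g \<in> B2 K \<sigma> p"
    then obtain h k where h: "continuous_map \<sigma> (discrete_topology {0..<int p}) h" "f = coboundary K p h"
      and k: "continuous_map \<sigma> (discrete_topology {0..<int p}) k" "g = coboundary K p k"
      by (auto simp: B2_coboundary)
    have c: "continuous_map \<sigma> (discrete_topology {0..<int p}) (\<lambda>x. (h x + k x) mod int p)"
      by (rule continuous_map_discrete_binop[OF h(1) k(1)]) (use p_pos in auto)
    have "f \<otimes>\<^bsub>Z\<^esub> g = coboundary K p (\<lambda>x. (h x + k x) mod int p)"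
      by (auto simp: h k mult_Z coboundary_def intro!: ext mod_add_alternating)
    then show "f \<otimes>\<^bsub>Z\<^esub> g \<in> B2 K \<sigma> p" using c by (auto simp: B2_coboundary)
  qed
qed

lemma normal_B2: "B2 K \<sigma> p \<lhd> Z"
  by (rule comm_group.subgroup_imp_normal[OF comm_group_Z subgroup_B2])

abbreviation "H \<equiv> H2 K \<sigma> p"
abbreviation "cls f \<equiv> B2 K \<sigma> p #>\<^bsub>Z\<^esub> f"

lemma group_H2: "group H"
  unfolding H2_def by (rule normal.factorgroup_is_group[OF normal_B2])

lemma carrier_H2: "carrier H = cls ` Z2 K \<sigma> p"
  by (simp add: H2_def carrier_FactGroup carrier_Z)

lemma mult_cls: "f \<in> Z2 K \<sigma> p \<Longrightarrow> g \<in> Z2 K \<sigma> p \<Longrightarrow> cls f \<otimes>\<^bsub>H\<^esub> cls g = cls (\<lambda>x y. (f x y + g x y) mod int p)"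
  using normal.rcos_sum[OF normal_B2, of f g] by (simp add: H2_def carrier_Z mult_Z)

lemma one_H2: "\<one>\<^bsub>H\<^esub> = B2 K \<sigma> p" by (simp add: H2_def)

lemma cls_mem: "g \<in> cls f \<longleftrightarrow> (\<exists>h. continuous_map \<sigma> (discrete_topology {0..<int p}) h
    \<and> g = (\<lambda>x y. (coboundary K p h x y + f x y) mod int p))"
  by (auto simp: r_coset_def B2_coboundary mult_Z)

text \<open>Together with \<open>cls_eqD\<close> this replaces equality of cosets by an explicit
  continuous 1-cochain; later comparisons of classes go through these two.\<close>

lemma cls_eqI:
  assumes f: "f \<in> Z2 K \<sigma> p" "g \<in> Z2 K \<sigma> p"
    and h: "continuous_map \<sigma> (discrete_topology {0..<int p}) h"
    and "\<And>x y. x \<in> carrier K \<Longrightarrow> y \<in> carrier K \<Longrightarrow> [f x y = g x y + (h y - h (x \<otimes> y) + h x)] (mod int p)"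
  shows "cls f = cls g"
proof -
  interpret Z: comm_group Z by (rule comm_group_Z)
  have "f = (\<lambda>x y. (coboundary K p h x y + g x y) mod int p)"
    by (rule Z2_ext[OF f(1) Z2_add[OF coboundary_Z2[OF h] f(2)]])
      (use assms(4) in \<open>simp add: coboundary_def cong_def mod_simps algebra_simps\<close>)
  then have "f \<in> cls g" using cls_mem h by blast
  then show ?thesis
    using Z.repr_independence[OF _ _ subgroup_B2] f by (auto simp: carrier_Z)
qed

lemma cls_eqD:
  assumes f: "f \<in> Z2 K \<sigma> p" and eq: "cls f = cls g"
  shows "\<exists>h. continuous_map \<sigma> (discrete_topology {0..<int p}) h
    \<and> (\<forall>x\<in>carrier K. \<forall>y\<in>carrier K. [f x y = g x y + (h y - h (x \<otimes> y) + h x)] (mod int p))"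
proof -
  interpret Z: comm_group Z by (rule comm_group_Z)
  have "f \<in> cls f" using Z.rcos_self[OF _ subgroup_B2] f by (auto simp: carrier_Z)
  then have "f \<in> cls g" using eq by simp
  then obtain h where h: "continuous_map \<sigma> (discrete_topology {0..<int p}) h"
      and fe: "f = (\<lambda>x y. (coboundary K p h x y + g x y) mod int p)" using cls_mem by blast
  have "[f x y = g x y + (h y - h (x \<otimes> y) + h x)] (mod int p)" if "x \<in> carrier K" "y \<in> carrier K" for x y
    using that by (subst fe) (simp add: coboundary_def cong_def mod_simps algebra_simps)
  then show ?thesis using h by blast
qed

lemma cls_zero: "cls (\<lambda>x y. 0) = \<one>\<^bsub>H\<^esub>"
  using group.coset_join2[OF comm_group.axioms(2)[OF comm_group_Z] _ subgroup_B2, of "\<one>\<^bsub>Z\<^esub>"]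
    subgroup.one_closed[OF subgroup_B2] Z2_zero
  by (simp add: one_H2 one_Z carrier_Z)

end

section \<open>Functoriality of H^2\<close>

lemma pull2_Z2:
  assumes "cochains K \<sigma> p" "cochains L \<upsilon> p" and \<phi>: "\<phi> \<in> chom L \<upsilon> K \<sigma>" and f: "f \<in> Z2 K \<sigma> p"
  shows "pull2 L \<phi> f \<in> Z2 L \<upsilon> p"
proof -
  interpret K: cochains K \<sigma> p by (rule assms)
  interpret L: cochains L \<upsilon> p by (rule assms)
  have hom: "\<phi> x \<in> carrier K" "\<phi> (x \<otimes>\<^bsub>L\<^esub> y) = \<phi> x \<otimes>\<^bsub>K\<^esub> \<phi> y" if "x \<in> carrier L" "y \<in> carrier L" for x y
    using \<phi> that by (auto simp: chom_def hom_def)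
  have c: "continuous_map \<upsilon> \<sigma> \<phi>" using \<phi> by (simp add: chom_def)
  show ?thesis
  proof (rule L.Z2I)
    have "continuous_map (prod_topology \<upsilon> \<upsilon>) (prod_topology \<sigma> \<sigma>) (\<lambda>(x, y). (\<phi> x, \<phi> y))"
      unfolding case_prod_unfold
      using continuous_map_compose[OF continuous_map_fst c] continuous_map_compose[OF continuous_map_snd c]
      by (intro continuous_map_pairedI) (auto simp: o_def)
    from continuous_map_compose[OF this K.Z2D(1)[OF f]]
    show "continuous_map (prod_topology \<upsilon> \<upsilon>) (discrete_topology {0..<int p}) (\<lambda>(x, y). pull2 L \<phi> f x y)"
      by (rule continuous_map_eq) (auto simp: pull2_def L.topspace_eq)
  next
    fix x y z assume "x \<in> carrier L" "y \<in> carrier L" "z \<in> carrier L"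
    then show "[pull2 L \<phi> f y z - pull2 L \<phi> f (x \<otimes>\<^bsub>L\<^esub> y) z + pull2 L \<phi> f x (y \<otimes>\<^bsub>L\<^esub> z) - pull2 L \<phi> f x y = 0] (mod int p)"
      using K.Z2D(4)[OF f, of "\<phi> x" "\<phi> y" "\<phi> z"] by (simp add: pull2_def hom)
  qed (auto simp: pull2_def)
qed

text \<open>\<open>H2_pull\<close> evaluates at a representative picked by \<open>SOME\<close>. The
  choice is harmless: two representatives differ by the coboundary of some \<open>h\<close>, whose
  pullback is the coboundary of \<open>h \<circ> \<phi>\<close>.\<close>

lemma H2_pull_coset:
  assumes "cochains K \<sigma> p" "cochains L \<upsilon> p" and \<phi>: "\<phi> \<in> chom L \<upsilon> K \<sigma>" and f: "f \<in> Z2 K \<sigma> p"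
  shows "H2_pull L \<upsilon> p \<phi> (B2 K \<sigma> p #>\<^bsub>Z2grp K \<sigma> p\<^esub> f) = B2 L \<upsilon> p #>\<^bsub>Z2grp L \<upsilon> p\<^esub> pull2 L \<phi> f"
proof -
  interpret K: cochains K \<sigma> p by (rule assms)
  interpret L: cochains L \<upsilon> p by (rule assms)
  interpret Z: comm_group "Z2grp K \<sigma> p" by (rule K.comm_group_Z)
  have hom: "\<phi> x \<in> carrier K" "\<phi> (x \<otimes>\<^bsub>L\<^esub> y) = \<phi> x \<otimes>\<^bsub>K\<^esub> \<phi> y" if "x \<in> carrier L" "y \<in> carrier L" for x y
    using \<phi> that by (auto simp: chom_def hom_def)
  have c: "continuous_map \<upsilon> \<sigma> \<phi>" using \<phi> by (simp add: chom_def)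
  define g where "g = (SOME g. g \<in> K.cls f)"
  have "\<exists>g. g \<in> K.cls f" using Z.rcos_self[OF _ K.subgroup_B2] f by (auto simp: K.carrier_Z)
  then have g: "g \<in> K.cls f" unfolding g_def by (rule someI_ex)
  then obtain h where h: "continuous_map \<sigma> (discrete_topology {0..<int p}) h"
    and ge: "g = (\<lambda>x y. (coboundary K p h x y + f x y) mod int p)" using K.cls_mem by blast
  have gZ: "g \<in> Z2 K \<sigma> p" unfolding ge by (intro K.Z2_add K.coboundary_Z2 h f)
  have "L.cls (pull2 L \<phi> g) = L.cls (pull2 L \<phi> f)"
  proof (rule L.cls_eqI)
    show "continuous_map \<upsilon> (discrete_topology {0..<int p}) (h \<circ> \<phi>)" by (rule continuous_map_compose[OF c h])
    fix x y assume "x \<in> carrier L" "y \<in> carrier L"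
    then show "[pull2 L \<phi> g x y = pull2 L \<phi> f x y + ((h \<circ> \<phi>) y - (h \<circ> \<phi>) (x \<otimes>\<^bsub>L\<^esub> y) + (h \<circ> \<phi>) x)] (mod int p)"
      by (simp add: pull2_def ge hom coboundary_def cong_def mod_simps algebra_simps)
  qed (use pull2_Z2[OF assms(1-3)] gZ f in auto)
  then show ?thesis by (simp add: H2_pull_def g_def)
qed

lemma H2_pull_hom:
  assumes "cochains K \<sigma> p" "cochains L \<upsilon> p" and \<phi>: "\<phi> \<in> chom L \<upsilon> K \<sigma>"
  shows "H2_pull L \<upsilon> p \<phi> \<in> hom (H2 K \<sigma> p) (H2 L \<upsilon> p)"
proof -
  interpret K: cochains K \<sigma> p by (rule assms)
  interpret L: cochains L \<upsilon> p by (rule assms)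
  have "pull2 L \<phi> (\<lambda>x y. (f x y + g x y) mod int p) = (\<lambda>x y. (pull2 L \<phi> f x y + pull2 L \<phi> g x y) mod int p)" for f g
    by (auto simp: pull2_def intro!: ext)
  then show ?thesis
    by (auto simp: hom_def K.carrier_H2 L.carrier_H2 H2_pull_coset[OF assms] pull2_Z2[OF assms]
        K.mult_cls L.mult_cls K.Z2_add)
qed

section \<open>Quotients of topological groups\<close>

text \<open>\<open>qtop\<close> is given through \<open>topology\<close>, so nothing can be read off
  from it before its open sets are known to form a topology. The quotient map property then carries
  all that is used later.\<close>

lemma quotient_map_qtop: "quotient_map \<tau> (qtop \<tau> q) q"
proof -
  have "istopology (\<lambda>V. V \<subseteq> q ` topspace \<tau> \<and> openin \<tau> (topspace \<tau> \<inter> q -` V))"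
    unfolding istopology_def
  proof (rule conjI; intro allI impI conjI)
    fix V W assume V: "V \<subseteq> q ` topspace \<tau> \<and> openin \<tau> (topspace \<tau> \<inter> q -` V)"
      and W: "W \<subseteq> q ` topspace \<tau> \<and> openin \<tau> (topspace \<tau> \<inter> q -` W)"
    have "topspace \<tau> \<inter> q -` (V \<inter> W) = (topspace \<tau> \<inter> q -` V) \<inter> (topspace \<tau> \<inter> q -` W)" by auto
    then show "openin \<tau> (topspace \<tau> \<inter> q -` (V \<inter> W))" using V W by auto
    show "V \<inter> W \<subseteq> q ` topspace \<tau>" using V by auto
  next
    fix \<V> assume V: "\<forall>V\<in>\<V>. V \<subseteq> q ` topspace \<tau> \<and> openin \<tau> (topspace \<tau> \<inter> q -` V)"
    have "topspace \<tau> \<inter> q -` (\<Union>\<V>) = (\<Union>V\<in>\<V>. topspace \<tau> \<inter> q -` V)" by auto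
    moreover have "openin \<tau> (\<Union>V\<in>\<V>. topspace \<tau> \<inter> q -` V)" using V by blast
    ultimately show "openin \<tau> (topspace \<tau> \<inter> q -` (\<Union>\<V>))" by metis
    show "\<Union>\<V> \<subseteq> q ` topspace \<tau>" using V by auto
  qed
  then have *: "openin (qtop \<tau> q) V \<longleftrightarrow> V \<subseteq> q ` topspace \<tau> \<and> openin \<tau> (topspace \<tau> \<inter> q -` V)" for V
    by (simp add: qtop_def topology_inverse')
  have "topspace \<tau> \<inter> q -` (q ` topspace \<tau>) = topspace \<tau>" by auto
  then have "openin (qtop \<tau> q) (q ` topspace \<tau>)" using * by simp
  then have "topspace (qtop \<tau> q) = q ` topspace \<tau>"
    using * openin_subset openin_topspace by (metis subset_antisym)
  moreover have "{x \<in> topspace \<tau>. q x \<in> V} = topspace \<tau> \<inter> q -` V" for V by auto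
  ultimately show ?thesis using * by (auto simp: quotient_map_def)
qed

lemma topspace_qtop: "topspace (qtop \<tau> q) = q ` topspace \<tau>"
  using quotient_map_qtop[of \<tau> q] by (simp add: quotient_map_def)

lemma continuous_map_qtop: "continuous_map \<tau> (qtop \<tau> q) q"
  by (rule quotient_imp_continuous_map[OF quotient_map_qtop])

lemma continuous_map_from_qtop:
  assumes "continuous_map \<tau> \<upsilon> f" "\<And>x. x \<in> topspace \<tau> \<Longrightarrow> g (q x) = f x"
  shows "continuous_map (qtop \<tau> q) \<upsilon> g"
proof (rule continuous_compose_quotient_map[OF quotient_map_qtop])
  show "continuous_map \<tau> \<upsilon> (g \<circ> q)"
    by (rule continuous_map_eq[OF assms(1)]) (simp add: assms(2))
qed

lemma compact_space_qtop: "compact_space \<tau> \<Longrightarrow> compact_space (qtop \<tau> q)"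
  by (metis compact_space_def continuous_map_qtop image_compactin topspace_qtop)

context topological_group
begin

lemma left_translation_continuous: "a \<in> carrier K \<Longrightarrow> continuous_map \<sigma> \<sigma> (\<lambda>x. a \<otimes> x)"
  using continuous_map_compose[OF _ mult_continuous, of \<sigma> "\<lambda>x. (a, x)"]
  by (simp add: o_def topspace_eq continuous_map_pairwise)

text \<open>The saturation of \<open>U\<close> is the union of its preimages under left translation
  by elements of \<open>N\<close>, each of which is open.\<close>

lemma open_map_coset:
  assumes N: "subgroup N K"
  shows "open_map \<sigma> (qtop \<sigma> (\<lambda>x. N #> x)) (\<lambda>x. N #> x)"
  unfolding open_map_def
proof (intro allI impI)
  fix U assume U: "openin \<sigma> U"
  then have UK: "U \<subseteq> carrier K" using openin_subset topspace_eq by fastforce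
  have NK: "N \<subseteq> carrier K" using N by (rule subgroup.subset)
  have "{x \<in> topspace \<sigma>. N #> x \<in> (\<lambda>x. N #> x) ` U} = (\<Union>a\<in>N. {x \<in> topspace \<sigma>. a \<otimes> x \<in> U})"
  proof (intro equalityI subsetI)
    fix x assume "x \<in> {x \<in> topspace \<sigma>. N #> x \<in> (\<lambda>x. N #> x) ` U}"
    then obtain u where u: "x \<in> carrier K" "u \<in> U" "N #> x = N #> u" by (auto simp: topspace_eq)
    then have "u \<in> N #> x" using rcos_self[OF _ N] UK by blast
    then obtain a where "a \<in> N" "u = a \<otimes> x" by (auto simp: r_coset_def)
    then show "x \<in> (\<Union>a\<in>N. {x \<in> topspace \<sigma>. a \<otimes> x \<in> U})" using u topspace_eq by auto
  next
    fix x assume "x \<in> (\<Union>a\<in>N. {x \<in> topspace \<sigma>. a \<otimes> x \<in> U})"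
    then obtain a where a: "a \<in> N" "x \<in> carrier K" "a \<otimes> x \<in> U" by (auto simp: topspace_eq)
    then have "N #> (a \<otimes> x) = N #> x"
      using NK coset_mult_assoc[OF NK] coset_join2[OF _ N] by (metis subsetD)
    then show "x \<in> {x \<in> topspace \<sigma>. N #> x \<in> (\<lambda>x. N #> x) ` U}"
      using a topspace_eq by (auto intro!: image_eqI[of _ _ "a \<otimes> x"])
  qed
  moreover have "openin \<sigma> {x \<in> topspace \<sigma>. a \<otimes> x \<in> U}" if "a \<in> N" for a
    using openin_continuous_map_preimage[OF left_translation_continuous U] NK that by blast
  ultimately have "openin \<sigma> {x \<in> topspace \<sigma>. N #> x \<in> (\<lambda>x. N #> x) ` U}" by auto
  moreover have "(\<lambda>x. N #> x) ` U \<subseteq> topspace (qtop \<sigma> (\<lambda>x. N #> x))"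
    using UK by (auto simp: topspace_qtop topspace_eq)
  ultimately show "openin (qtop \<sigma> (\<lambda>x. N #> x)) ((\<lambda>x. N #> x) ` U)"
    using quotient_map_qtop[of \<sigma> "\<lambda>x. N #> x"] unfolding quotient_map_def by blast
qed

text \<open>A product of quotient maps need not be a quotient map, so the multiplication of the
  quotient cannot simply be factored. Instead a basic open box is found upstairs and pushed down,
  its image being open by \<open>open_map_coset\<close>.\<close>

lemma topological_group_Mod:
  assumes N: "N \<lhd> K"
  shows "topological_group (K Mod N) (qtop \<sigma> (\<lambda>x. N #> x))"
proof -
  interpret N: normal N K by (rule N)
  let ?q = "\<lambda>x. N #> x"
  let ?Q = "qtop \<sigma> ?q"
  show ?thesis
  proof (intro topological_group.intro topological_group_axioms.intro N.factorgroup_is_group)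
    show top: "topspace ?Q = carrier (K Mod N)"
      by (simp add: topspace_qtop topspace_eq carrier_FactGroup)
    have *: "\<exists>A B. openin ?Q A \<and> openin ?Q B \<and> a \<in> A \<and> b \<in> B \<and> A \<times> B \<subseteq> {u \<in> topspace (prod_topology ?Q ?Q). (case u of (x, y) \<Rightarrow> x \<otimes>\<^bsub>K Mod N\<^esub> y) \<in> V}"
      if V: "openin ?Q V" and ab: "a \<in> carrier (K Mod N)" "b \<in> carrier (K Mod N)" "a \<otimes>\<^bsub>K Mod N\<^esub> b \<in> V" for V a b
    proof -
      obtain x y where x: "x \<in> carrier K" "a = N #> x" and y: "y \<in> carrier K" "b = N #> y"
        using ab by (auto simp: carrier_FactGroup)
      have "continuous_map (prod_topology \<sigma> \<sigma>) ?Q (?q \<circ> (\<lambda>(x, y). x \<otimes> y))"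
        by (rule continuous_map_compose[OF mult_continuous continuous_map_qtop])
      from openin_continuous_map_preimage[OF this V]
      have "openin (prod_topology \<sigma> \<sigma>) {u \<in> topspace (prod_topology \<sigma> \<sigma>). (?q \<circ> (\<lambda>(x, y). x \<otimes> y)) u \<in> V}" .
      moreover have "(x, y) \<in> {u \<in> topspace (prod_topology \<sigma> \<sigma>). (?q \<circ> (\<lambda>(x, y). x \<otimes> y)) u \<in> V}"
        using x y ab(3) by (simp add: topspace_eq N.rcos_sum)
      ultimately obtain A B where A: "openin \<sigma> A" "x \<in> A" and B: "openin \<sigma> B" "y \<in> B"
        and AB: "A \<times> B \<subseteq> {u \<in> topspace (prod_topology \<sigma> \<sigma>). (?q \<circ> (\<lambda>(x, y). x \<otimes> y)) u \<in> V}"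
        unfolding openin_prod_topology_alt by blast
      have o: "openin ?Q (?q ` A)" "openin ?Q (?q ` B)"
        using open_map_coset[OF N.subgroup_axioms] A B by (auto simp: open_map_def)
      have sub: "A \<subseteq> carrier K" "B \<subseteq> carrier K" using A B openin_subset topspace_eq by fastforce+
      have "?q ` A \<times> ?q ` B \<subseteq> {u \<in> topspace (prod_topology ?Q ?Q). (case u of (x, y) \<Rightarrow> x \<otimes>\<^bsub>K Mod N\<^esub> y) \<in> V}"
      proof
        fix u assume "u \<in> ?q ` A \<times> ?q ` B"
        then obtain s t where st: "s \<in> A" "t \<in> B" "u = (N #> s, N #> t)" by auto
        then have "(s, t) \<in> {u \<in> topspace (prod_topology \<sigma> \<sigma>). (?q \<circ> (\<lambda>(x, y). x \<otimes> y)) u \<in> V}" using AB by blast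
        then show "u \<in> {u \<in> topspace (prod_topology ?Q ?Q). (case u of (x, y) \<Rightarrow> x \<otimes>\<^bsub>K Mod N\<^esub> y) \<in> V}"
          using st sub by (auto simp: topspace_qtop topspace_eq N.rcos_sum subsetD)
      qed
      then show ?thesis using o A B x y by blast
    qed
    show "continuous_map (prod_topology ?Q ?Q) ?Q (\<lambda>(x, y). x \<otimes>\<^bsub>K Mod N\<^esub> y)"
      unfolding continuous_map_def
    proof (intro conjI allI impI)
      interpret Q: group "K Mod N" by (rule N.factorgroup_is_group)
      show "(\<lambda>(x, y). x \<otimes>\<^bsub>K Mod N\<^esub> y) \<in> topspace (prod_topology ?Q ?Q) \<rightarrow> topspace ?Q"
        using Q.m_closed by (auto simp del: mult_FactGroup simp: top)
      fix V assume V: "openin ?Q V"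
      show "openin (prod_topology ?Q ?Q) {u \<in> topspace (prod_topology ?Q ?Q). (case u of (x, y) \<Rightarrow> x \<otimes>\<^bsub>K Mod N\<^esub> y) \<in> V}"
        unfolding openin_prod_topology_alt
        using *[OF V] by (auto simp del: mult_FactGroup simp: top)
    qed
  qed
qed

end

section \<open>Unitriangular matrices\<close>

lemma Unip_carrierD:
  assumes "A \<in> carrier (Unip p n)"
  shows "A i j \<in> {0..<int p}" "i \<notin> {1..n+1} \<or> j \<notin> {1..n+1} \<Longrightarrow> A i j = 0"
    "i \<in> {1..n+1} \<Longrightarrow> A i i = 1" "j < i \<Longrightarrow> A i j = 0"
  using assms by (auto simp: Unip_def)

lemma Unip_carrierI:
  assumes "\<And>i j. A i j \<in> {0..<int p}" "\<And>i j. i \<notin> {1..n+1} \<or> j \<notin> {1..n+1} \<Longrightarrow> A i j = 0"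
    "\<And>i. i \<in> {1..n+1} \<Longrightarrow> A i i = 1" "\<And>i j. j < i \<Longrightarrow> A i j = 0"
  shows "A \<in> carrier (Unip p n)"
  using assms by (auto simp: Unip_def)

lemma Unip_mult: "(A \<otimes>\<^bsub>Unip p n\<^esub> B) i j
    = (if i \<in> {1..n+1} \<and> j \<in> {1..n+1} then (\<Sum>k\<in>{1..n+1}. A i k * B k j) mod int p else 0)"
  by (simp add: Unip_def)

lemma Unip_one: "\<one>\<^bsub>Unip p n\<^esub> = (\<lambda>i j. if i = j \<and> i \<in> {1..n+1} then 1 else 0)"
  by (simp add: Unip_def)

lemma Unip_ext:
  assumes "A \<in> carrier (Unip p n)" "B \<in> carrier (Unip p n)"
    and "\<And>i j. i \<in> {1..n+1} \<Longrightarrow> j \<in> {1..n+1} \<Longrightarrow> A i j = B i j"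
  shows "A = B"
proof (intro ext)
  fix i j show "A i j = B i j"
    using assms(3)[of i j] Unip_carrierD(2)[OF assms(1), of i j] Unip_carrierD(2)[OF assms(2), of i j]
    by (cases "i \<in> {1..n+1} \<and> j \<in> {1..n+1}") auto
qed

lemma finite_Unip: "finite (carrier (Unip p n))"
proof -
  let ?S = "{f. \<forall>x. (x \<in> {1..n+1} \<times> {1..n+1} \<longrightarrow> f x \<in> {0..<int p}) \<and> (x \<notin> {1..n+1} \<times> {1..n+1} \<longrightarrow> f x = 0)}"
  have "finite ?S" by (intro finite_set_of_finite_funs) auto
  moreover have "carrier (Unip p n) \<subseteq> curry ` ?S"
  proof
    fix A assume A: "A \<in> carrier (Unip p n)"
    then have "case_prod A \<in> ?S" using Unip_carrierD(1,2)[OF A] by auto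
    then show "A \<in> curry ` ?S" by (intro image_eqI[of _ _ "case_prod A"]) simp
  qed
  ultimately show ?thesis by (rule finite_surj)
qed

context
  fixes p :: nat assumes p: "1 < p"
begin

lemma Unip_m_closed:
  assumes A: "A \<in> carrier (Unip p n)" and B: "B \<in> carrier (Unip p n)"
  shows "A \<otimes>\<^bsub>Unip p n\<^esub> B \<in> carrier (Unip p n)"
proof (rule Unip_carrierI)
  fix i assume i: "i \<in> {1..n+1}"
  have "(\<Sum>k\<in>{1..n+1}. A i k * B k i) = (\<Sum>k\<in>{1..n+1}. if k = i then 1 else 0)"
  proof (rule sum.cong)
    fix k assume "k \<in> {1..n+1}"
    then show "A i k * B k i = (if k = i then 1 else 0)"
      using Unip_carrierD(3,4)[OF A] Unip_carrierD(3,4)[OF B] by (cases k i rule: linorder_cases) auto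
  qed simp
  then show "(A \<otimes>\<^bsub>Unip p n\<^esub> B) i i = 1" using i p by (simp add: Unip_mult)
next
  fix i j :: nat assume ij: "j < i"
  have "A i k * B k j = 0" for k
    using Unip_carrierD(4)[OF A, of k i] Unip_carrierD(4)[OF B, of j k] ij by (cases "k < i") auto
  then have "(\<Sum>k\<in>{1..n+1}. A i k * B k j) = 0" by (intro sum.neutral) blast
  then show "(A \<otimes>\<^bsub>Unip p n\<^esub> B) i j = 0" by (simp only: Unip_mult mod_0 if_cancel)
qed (use p in \<open>auto simp: Unip_mult\<close>)

lemma Unip_one_closed: "\<one>\<^bsub>Unip p n\<^esub> \<in> carrier (Unip p n)"
  by (rule Unip_carrierI) (use p in \<open>auto simp: Unip_one\<close>)

lemma Unip_assoc:
  assumes "A \<in> carrier (Unip p n)" "B \<in> carrier (Unip p n)" "C \<in> carrier (Unip p n)"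
  shows "(A \<otimes>\<^bsub>Unip p n\<^esub> B) \<otimes>\<^bsub>Unip p n\<^esub> C = A \<otimes>\<^bsub>Unip p n\<^esub> (B \<otimes>\<^bsub>Unip p n\<^esub> C)"
proof (rule Unip_ext[where p = p and n = n])
  fix i j assume ij: "i \<in> {1..n+1}" "j \<in> {1..n+1}"
  let ?I = "{1..n+1}"
  have "((A \<otimes>\<^bsub>Unip p n\<^esub> B) \<otimes>\<^bsub>Unip p n\<^esub> C) i j = (\<Sum>k\<in>?I. ((\<Sum>l\<in>?I. A i l * B l k) mod int p) * C k j) mod int p"
    using ij by (simp add: Unip_mult)
  also have "\<dots> = (\<Sum>k\<in>?I. (\<Sum>l\<in>?I. A i l * B l k) * C k j) mod int p"
    by (subst (1 2) mod_sum_eq[symmetric]) (simp add: mod_mult_left_eq)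
  also have "(\<Sum>k\<in>?I. (\<Sum>l\<in>?I. A i l * B l k) * C k j) = (\<Sum>l\<in>?I. \<Sum>k\<in>?I. A i l * B l k * C k j)"
    by (subst sum.swap) (simp only: sum_distrib_right)
  also have "\<dots> = (\<Sum>l\<in>?I. A i l * (\<Sum>k\<in>?I. B l k * C k j))"
    by (simp only: sum_distrib_left mult.assoc)
  also have "\<dots> mod int p = (\<Sum>l\<in>?I. A i l * ((\<Sum>k\<in>?I. B l k * C k j) mod int p)) mod int p"
    by (subst (1 2) mod_sum_eq[symmetric]) (simp add: mod_mult_right_eq)
  also have "\<dots> = (A \<otimes>\<^bsub>Unip p n\<^esub> (B \<otimes>\<^bsub>Unip p n\<^esub> C)) i j"
    using ij by (simp add: Unip_mult)
  finally show "((A \<otimes>\<^bsub>Unip p n\<^esub> B) \<otimes>\<^bsub>Unip p n\<^esub> C) i j = (A \<otimes>\<^bsub>Unip p n\<^esub> (B \<otimes>\<^bsub>Unip p n\<^esub> C)) i j" .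
qed (simp_all add: assms Unip_m_closed)

lemma Unip_l_one:
  assumes A: "A \<in> carrier (Unip p n)"
  shows "\<one>\<^bsub>Unip p n\<^esub> \<otimes>\<^bsub>Unip p n\<^esub> A = A"
proof (rule Unip_ext[where p = p and n = n])
  fix i j assume ij: "i \<in> {1..n+1}" "j \<in> {1..n+1}"
  have "(\<Sum>k\<in>{1..n+1}. \<one>\<^bsub>Unip p n\<^esub> i k * A k j) = (\<Sum>k\<in>{1..n+1}. if k = i then A k j else 0)"
    by (rule sum.cong) (auto simp: Unip_one)
  then show "(\<one>\<^bsub>Unip p n\<^esub> \<otimes>\<^bsub>Unip p n\<^esub> A) i j = A i j"
    using ij Unip_carrierD(1)[OF A, of i j] by (simp add: Unip_mult)
qed (use A Unip_m_closed Unip_one_closed in auto)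

lemma Unip_r_one:
  assumes A: "A \<in> carrier (Unip p n)"
  shows "A \<otimes>\<^bsub>Unip p n\<^esub> \<one>\<^bsub>Unip p n\<^esub> = A"
proof (rule Unip_ext[where p = p and n = n])
  fix i j assume ij: "i \<in> {1..n+1}" "j \<in> {1..n+1}"
  have "(\<Sum>k\<in>{1..n+1}. A i k * \<one>\<^bsub>Unip p n\<^esub> k j) = (\<Sum>k\<in>{1..n+1}. if k = j then A i k else 0)"
    by (rule sum.cong) (auto simp: Unip_one)
  then show "(A \<otimes>\<^bsub>Unip p n\<^esub> \<one>\<^bsub>Unip p n\<^esub>) i j = A i j"
    using ij Unip_carrierD(1)[OF A, of i j] by (simp add: Unip_mult)
qed (use A Unip_m_closed Unip_one_closed in auto)

text \<open>Back substitution from the last row upwards: since \<open>A i i = 1\<close> and the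
  entries left of the diagonal vanish, row \<open>i\<close> of the product determines row
  \<open>i\<close> of the second factor once the rows below it are known.\<close>

lemma Unip_left_cancel:
  assumes A: "A \<in> carrier (Unip p n)" and B: "B \<in> carrier (Unip p n)" and C: "C \<in> carrier (Unip p n)"
    and eq: "A \<otimes>\<^bsub>Unip p n\<^esub> B = A \<otimes>\<^bsub>Unip p n\<^esub> C"
  shows "B = C"
proof (rule Unip_ext[OF B C])
  fix i j assume "i \<in> {1..n+1}" "j \<in> {1..n+1}"
  then show "B i j = C i j"
  proof (induction "n + 1 - i" arbitrary: i rule: less_induct)
    case less
    let ?I = "{1..n+1}"
    have split: "(\<Sum>k\<in>?I. A i k * D k j) = D i j + (\<Sum>k\<in>?I - {i}. A i k * D k j)" for D
      using less.prems Unip_carrierD(3)[OF A] by (subst sum.remove[of _ i]) auto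
    have rest: "(\<Sum>k\<in>?I - {i}. A i k * B k j) = (\<Sum>k\<in>?I - {i}. A i k * C k j)"
    proof (rule sum.cong)
      fix k assume k: "k \<in> ?I - {i}"
      show "A i k * B k j = A i k * C k j"
      proof (cases "k < i")
        case True
        then show ?thesis using Unip_carrierD(4)[OF A] by simp
      next
        case False
        then show ?thesis using less.hyps[of k] less.prems k by auto
      qed
    qed simp
    have "[(\<Sum>k\<in>?I. A i k * B k j) = (\<Sum>k\<in>?I. A i k * C k j)] (mod int p)"
      using fun_cong[OF fun_cong[OF eq, of i], of j] less.prems by (simp add: Unip_mult cong_def)
    then have "[B i j = C i j] (mod int p)"
      unfolding split rest by (simp add: cong_add_rcancel)
    then show ?case using cong_int_reduced Unip_carrierD(1)[OF B] Unip_carrierD(1)[OF C] by blast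
  qed
qed

text \<open>No inverse matrix is written down: left multiplication is injective on a finite set,
  hence onto, which gives right inverses. A right inverse of the right inverse of \<open>A\<close>
  equals \<open>A\<close>, so these inverses are two-sided.\<close>

lemma group_Unip: "group (Unip p n)"
proof (rule groupI)
  have right_inverse: "\<exists>B\<in>carrier (Unip p n). A \<otimes>\<^bsub>Unip p n\<^esub> B = \<one>\<^bsub>Unip p n\<^esub>" if A: "A \<in> carrier (Unip p n)" for A
  proof -
    have "inj_on (\<lambda>B. A \<otimes>\<^bsub>Unip p n\<^esub> B) (carrier (Unip p n))"
      using Unip_left_cancel[OF A] by (auto intro: inj_onI)
    then have "(\<lambda>B. A \<otimes>\<^bsub>Unip p n\<^esub> B) ` carrier (Unip p n) = carrier (Unip p n)"
      by (intro endo_inj_surj finite_Unip) (use A Unip_m_closed in auto)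
    then show ?thesis using Unip_one_closed by (metis (no_types, lifting) imageE)
  qed
  fix A assume A: "A \<in> carrier (Unip p n)"
  then obtain B where B: "B \<in> carrier (Unip p n)" "A \<otimes>\<^bsub>Unip p n\<^esub> B = \<one>\<^bsub>Unip p n\<^esub>" using right_inverse by blast
  then obtain C where C: "C \<in> carrier (Unip p n)" "B \<otimes>\<^bsub>Unip p n\<^esub> C = \<one>\<^bsub>Unip p n\<^esub>" using right_inverse by blast
  have "A = C" using Unip_assoc[OF A B(1) C(1)] B C A Unip_l_one Unip_r_one by simp
  then show "\<exists>B\<in>carrier (Unip p n). B \<otimes>\<^bsub>Unip p n\<^esub> A = \<one>\<^bsub>Unip p n\<^esub>" using B C by blast
qed (use Unip_m_closed Unip_one_closed Unip_assoc Unip_l_one in auto)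

section \<open>The central subgroup Z/p and the cocycle of the extension\<close>

definition add_corner :: "nat \<Rightarrow> int \<Rightarrow> (nat \<Rightarrow> nat \<Rightarrow> int) \<Rightarrow> nat \<Rightarrow> nat \<Rightarrow> int" where
  "add_corner n r A = (\<lambda>i j. if i = 1 \<and> j = n + 1 then (A i j + r) mod int p else A i j)"

lemma Zemb_closed: "1 \<le> n \<Longrightarrow> r \<in> {0..<int p} \<Longrightarrow> Zemb n r \<in> carrier (Unip p n)"
  by (rule Unip_carrierI) (use p in \<open>auto simp: Zemb_def\<close>)

text \<open>Multiplication by \<open>Zemb n r\<close> from the left and from the right leads to the
  same \<open>add_corner\<close>, which is the centrality of Z/p. The condition
  \<open>1 \<le> n\<close> keeps the corner off the diagonal.\<close>

lemma Zemb_mult_left: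
  assumes n: "1 \<le> n" and A: "A \<in> carrier (Unip p n)"
  shows "Zemb n r \<otimes>\<^bsub>Unip p n\<^esub> A = add_corner n r A"
proof (intro ext)
  fix i j
  let ?I = "{1..n+1}"
  show "(Zemb n r \<otimes>\<^bsub>Unip p n\<^esub> A) i j = add_corner n r A i j"
  proof (cases "i \<in> ?I \<and> j \<in> ?I")
    case True
    have "(\<Sum>k\<in>?I. Zemb n r i k * A k j) = (\<Sum>k\<in>?I. (if k = i then A k j else 0) + (if k = n+1 then (if i = 1 then r * A k j else 0) else 0))"
      by (rule sum.cong) (use n True in \<open>auto simp: Zemb_def\<close>)
    also have "\<dots> = A i j + (if i = 1 then r * A (n+1) j else 0)"
      using True by (simp add: sum.distrib)
    \<comment> \<open>The last row of a unitriangular matrix is the last unit vector, so adding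
      \<open>r\<close> times it to the first row changes the corner only.\<close>
    also have "A (n+1) j = (if j = n+1 then 1 else 0)"
      using Unip_carrierD(3,4)[OF A] True by auto
    finally show ?thesis
      using True Unip_carrierD(1)[OF A, of i j] n
      by (cases "i = 1"; cases "j = n + 1") (simp_all add: Unip_mult add_corner_def)
  next
    case False
    then show ?thesis using Unip_carrierD(2)[OF A, of i j] by (auto simp: Unip_mult add_corner_def)
  qed
qed

lemma Zemb_mult_right:
  assumes n: "1 \<le> n" and A: "A \<in> carrier (Unip p n)"
  shows "A \<otimes>\<^bsub>Unip p n\<^esub> Zemb n r = add_corner n r A"
proof (intro ext)
  fix i j
  let ?I = "{1..n+1}"
  show "(A \<otimes>\<^bsub>Unip p n\<^esub> Zemb n r) i j = add_corner n r A i j"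
  proof (cases "i \<in> ?I \<and> j \<in> ?I")
    case True
    have "(\<Sum>k\<in>?I. A i k * Zemb n r k j) = (\<Sum>k\<in>?I. (if k = j then A i k else 0) + (if k = 1 then (if j = n + 1 then A i k * r else 0) else 0))"
      by (rule sum.cong) (use n True in \<open>auto simp: Zemb_def\<close>)
    also have "\<dots> = A i j + (if j = n + 1 then A i 1 * r else 0)"
      using True by (simp add: sum.distrib)
    also have "A i 1 = (if i = 1 then 1 else 0)"
      using Unip_carrierD(3,4)[OF A] True by auto
    finally show ?thesis
      using True Unip_carrierD(1)[OF A, of i j] n
      by (cases "i = 1"; cases "j = n + 1") (simp_all add: Unip_mult add_corner_def)
  next
    case False
    then show ?thesis using Unip_carrierD(2)[OF A, of i j] by (auto simp: Unip_mult add_corner_def)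
  qed
qed

lemma Zemb_add:
  "1 \<le> n \<Longrightarrow> r \<in> {0..<int p} \<Longrightarrow> s \<in> {0..<int p} \<Longrightarrow> Zemb n r \<otimes>\<^bsub>Unip p n\<^esub> Zemb n s = Zemb n ((r + s) mod int p)"
  by (subst Zemb_mult_left[OF _ Zemb_closed]) (auto simp: add_corner_def Zemb_def add.commute intro!: ext)

lemma Zemb_0: "Zemb n 0 = \<one>\<^bsub>Unip p n\<^esub>"
  by (auto simp: Zemb_def Unip_one intro!: ext)

lemma normal_Zc:
  assumes n: "1 \<le> n"
  shows "Zc p n \<lhd> Unip p n"
proof -
  interpret U: group "Unip p n" by (rule group_Unip)
  have "subgroup (Zc p n) (Unip p n)"
  proof (rule U.subgroupI)
    show "Zc p n \<subseteq> carrier (Unip p n)" using Zemb_closed n by (auto simp: Zc_def)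
    show "Zc p n \<noteq> {}" using p by (auto simp: Zc_def)
  next
    fix A assume "A \<in> Zc p n"
    then obtain r where r: "r \<in> {0..<int p}" "A = Zemb n r" by (auto simp: Zc_def)
    have m: "(- r) mod int p \<in> {0..<int p}" using p by auto
    have "inv\<^bsub>Unip p n\<^esub> A = Zemb n ((- r) mod int p)"
      unfolding r(2) by (rule U.inv_equality) (use r m n Zemb_closed Zemb_add Zemb_0 in \<open>simp_all add: mod_simps\<close>)
    then show "inv\<^bsub>Unip p n\<^esub> A \<in> Zc p n" using m by (auto simp: Zc_def)
  next
    fix A B assume "A \<in> Zc p n" "B \<in> Zc p n"
    then obtain r s where "r \<in> {0..<int p}" "A = Zemb n r" "s \<in> {0..<int p}" "B = Zemb n s" by (auto simp: Zc_def)
    then show "A \<otimes>\<^bsub>Unip p n\<^esub> B \<in> Zc p n" using Zemb_add[OF n] p by (auto simp: Zc_def)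
  qed
  moreover have "Zc p n #>\<^bsub>Unip p n\<^esub> A = A <#\<^bsub>Unip p n\<^esub> Zc p n" if "A \<in> carrier (Unip p n)" for A
    using that n by (simp add: r_coset_def l_coset_def Zc_def Zemb_mult_left Zemb_mult_right)
  ultimately show ?thesis by (intro U.normalI) auto
qed

lemma lam_eq: "1 \<le> n \<Longrightarrow> A \<in> carrier (Unip p n) \<Longrightarrow> lam p n A = {add_corner n r A | r. r \<in> {0..<int p}}"
  by (auto simp: lam_def r_coset_def Zc_def Zemb_mult_left)

lemma lam_mult: "1 \<le> n \<Longrightarrow> A \<in> carrier (Unip p n) \<Longrightarrow> B \<in> carrier (Unip p n)
  \<Longrightarrow> lam p n A \<otimes>\<^bsub>Ubar p n\<^esub> lam p n B = lam p n (A \<otimes>\<^bsub>Unip p n\<^esub> B)"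
  using normal.rcos_sum[OF normal_Zc] by (simp add: lam_def Ubar_def)

lemma carrier_Ubar: "carrier (Ubar p n) = lam p n ` carrier (Unip p n)"
  by (simp add: Ubar_def lam_def carrier_FactGroup)

lemma group_Ubar: "1 \<le> n \<Longrightarrow> group (Ubar p n)"
  unfolding Ubar_def by (rule normal.factorgroup_is_group[OF normal_Zc])

text \<open>\<open>Zemb n (sec_corner n A)\<close> carries \<open>A\<close> to the section value used in \<open>alpha_cocycle\<close>;
  over \<open>Unip p n\<close> this splits the cocycle.\<close>
definition sec_corner :: "nat \<Rightarrow> (nat \<Rightarrow> nat \<Rightarrow> int) \<Rightarrow> int" where
  "sec_corner n A = ((SOME B. B \<in> lam p n A) 1 (n + 1) - A 1 (n + 1)) mod int p"

lemma section_eq: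
  assumes n: "1 \<le> n" and A: "A \<in> carrier (Unip p n)"
  shows "(SOME B. B \<in> lam p n A) = Zemb n (sec_corner n A) \<otimes>\<^bsub>Unip p n\<^esub> A"
proof -
  interpret U: group "Unip p n" by (rule group_Unip)
  have "\<exists>B. B \<in> lam p n A"
    using U.rcos_self[OF A normal_imp_subgroup[OF normal_Zc[OF n]]] by (auto simp: lam_def)
  then have "(SOME B. B \<in> lam p n A) \<in> lam p n A" by (rule someI_ex)
  then obtain r where r: "r \<in> {0..<int p}" "(SOME B. B \<in> lam p n A) = add_corner n r A"
    using lam_eq[OF n A] by auto
  have "sec_corner n A = r"
    using r(1) by (simp add: sec_corner_def r(2)) (simp add: add_corner_def mod_simps)
  then show ?thesis using r Zemb_mult_left[OF n A] by simp
qed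

text \<open>The chosen lift of \<open>lam p n A\<close> is a central multiple of \<open>A\<close>.
  In the product defining the cocycle the matrices cancel and the central factors remain, so over
  \<open>Unip p n\<close> the cocycle is the coboundary of \<open>sec_corner\<close>.\<close>

lemma alpha_cocycle_lam:
  assumes n: "1 \<le> n" and A: "A \<in> carrier (Unip p n)" and B: "B \<in> carrier (Unip p n)"
  shows "alpha_cocycle p n (lam p n A) (lam p n B)
    = (sec_corner n B - sec_corner n (A \<otimes>\<^bsub>Unip p n\<^esub> B) + sec_corner n A) mod int p"
proof -
  interpret U: group "Unip p n" by (rule group_Unip)
  let ?a = "sec_corner n A" and ?b = "sec_corner n B" and ?c = "sec_corner n (A \<otimes>\<^bsub>Unip p n\<^esub> B)"
  let ?r = "(?b - ?c + ?a) mod int p"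
  have R: "?a \<in> {0..<int p}" "?b \<in> {0..<int p}" "?c \<in> {0..<int p}" "?r \<in> {0..<int p}"
    using p by (auto simp: sec_corner_def)
  have AB: "A \<otimes>\<^bsub>Unip p n\<^esub> B \<in> carrier (Unip p n)" using A B by simp
  note Z = Zemb_closed[OF n R(1)] Zemb_closed[OF n R(2)] Zemb_closed[OF n R(3)] Zemb_closed[OF n R(4)]
  have comm: "A \<otimes>\<^bsub>Unip p n\<^esub> Zemb n ?b = Zemb n ?b \<otimes>\<^bsub>Unip p n\<^esub> A"
    using Zemb_mult_left[OF n A] Zemb_mult_right[OF n A] by simp
  have "(Zemb n ?a \<otimes>\<^bsub>Unip p n\<^esub> A) \<otimes>\<^bsub>Unip p n\<^esub> (Zemb n ?b \<otimes>\<^bsub>Unip p n\<^esub> B)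
      = Zemb n ?a \<otimes>\<^bsub>Unip p n\<^esub> (A \<otimes>\<^bsub>Unip p n\<^esub> Zemb n ?b) \<otimes>\<^bsub>Unip p n\<^esub> B"
    using A B Z by (simp add: U.m_assoc)
  also have "\<dots> = (Zemb n ?a \<otimes>\<^bsub>Unip p n\<^esub> Zemb n ?b) \<otimes>\<^bsub>Unip p n\<^esub> (A \<otimes>\<^bsub>Unip p n\<^esub> B)"
    unfolding comm using A B Z by (simp add: U.m_assoc)
  \<comment> \<open>\<open>?r\<close> is chosen with \<open>?r + ?c = ?a + ?b\<close> modulo
    \<open>p\<close>, which exposes the factor to be cancelled by the lift of the product.\<close>
  also have "Zemb n ?a \<otimes>\<^bsub>Unip p n\<^esub> Zemb n ?b = Zemb n ?r \<otimes>\<^bsub>Unip p n\<^esub> Zemb n ?c"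
    using Zemb_add[OF n R(1,2)] Zemb_add[OF n R(4,3)] by (simp add: mod_simps add.commute)
  finally have eq: "(Zemb n ?a \<otimes>\<^bsub>Unip p n\<^esub> A) \<otimes>\<^bsub>Unip p n\<^esub> (Zemb n ?b \<otimes>\<^bsub>Unip p n\<^esub> B)
      = Zemb n ?r \<otimes>\<^bsub>Unip p n\<^esub> (Zemb n ?c \<otimes>\<^bsub>Unip p n\<^esub> (A \<otimes>\<^bsub>Unip p n\<^esub> B))"
    using A B Z by (simp add: U.m_assoc)
  have "alpha_cocycle p n (lam p n A) (lam p n B)
      = (((Zemb n ?a \<otimes>\<^bsub>Unip p n\<^esub> A) \<otimes>\<^bsub>Unip p n\<^esub> (Zemb n ?b \<otimes>\<^bsub>Unip p n\<^esub> B))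
          \<otimes>\<^bsub>Unip p n\<^esub> inv\<^bsub>Unip p n\<^esub> (Zemb n ?c \<otimes>\<^bsub>Unip p n\<^esub> (A \<otimes>\<^bsub>Unip p n\<^esub> B))) 1 (n+1)"
    unfolding alpha_cocycle_def lam_mult[OF n A B] Let_def section_eq[OF n A] section_eq[OF n B] section_eq[OF n AB]
    using A B by (simp add: carrier_Ubar)
  also have "\<dots> = Zemb n ?r 1 (n+1)"
    unfolding eq using A B Z by (simp add: U.m_assoc)
  also have "\<dots> = ?r" using n by (simp add: Zemb_def)
  finally show ?thesis .
qed

section \<open>Block homomorphisms between unitriangular groups of neighbouring sizes\<close>

definition upper_left :: "nat \<Rightarrow> (nat \<Rightarrow> nat \<Rightarrow> int) \<Rightarrow> nat \<Rightarrow> nat \<Rightarrow> int" where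
  "upper_left m A = (\<lambda>i j. if i \<in> {1..m+1} \<and> j \<in> {1..m+1} then A i j else 0)"

definition lower_right :: "nat \<Rightarrow> (nat \<Rightarrow> nat \<Rightarrow> int) \<Rightarrow> nat \<Rightarrow> nat \<Rightarrow> int" where
  "lower_right m A = (\<lambda>i j. if i \<in> {1..m+1} \<and> j \<in> {1..m+1} then A (Suc i) (Suc j) else 0)"

text \<open>The block embedding into the next size. Through it a homomorphism to
  \<open>Unip p m\<close> that is nontrivial at a point stays so one size up, which later places M
  inside N.\<close>

definition pad_one :: "nat \<Rightarrow> (nat \<Rightarrow> nat \<Rightarrow> int) \<Rightarrow> nat \<Rightarrow> nat \<Rightarrow> int" where
  "pad_one m A = (\<lambda>i j. if i = m + 2 \<and> j = m + 2 then 1 else A i j)"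

lemma upper_left_hom: "upper_left m \<in> hom (Unip p (Suc m)) (Unip p m)"
proof (rule homI)
  fix A assume A: "A \<in> carrier (Unip p (Suc m))"
  show "upper_left m A \<in> carrier (Unip p m)"
    by (rule Unip_carrierI) (use p Unip_carrierD[OF A] in \<open>auto simp: upper_left_def\<close>)
  fix B assume B: "B \<in> carrier (Unip p (Suc m))"
  show "upper_left m (A \<otimes>\<^bsub>Unip p (Suc m)\<^esub> B) = upper_left m A \<otimes>\<^bsub>Unip p m\<^esub> upper_left m B"
  proof (intro ext)
    fix i j
    show "upper_left m (A \<otimes>\<^bsub>Unip p (Suc m)\<^esub> B) i j = (upper_left m A \<otimes>\<^bsub>Unip p m\<^esub> upper_left m B) i j"
    proof (cases "i \<in> {1..m+1} \<and> j \<in> {1..m+1}")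
      case True
      \<comment> \<open>The extra summand contains \<open>B (m + 2) j\<close>, which lies below the
        diagonal because \<open>j \<le> m + 1\<close>.\<close>
      have "(\<Sum>k\<in>{1..Suc m + 1}. A i k * B k j) = (\<Sum>k\<in>{1..m+1}. A i k * B k j)"
        using Unip_carrierD(4)[OF B, of j "Suc (Suc m)"] True by simp
      also have "\<dots> = (\<Sum>k\<in>{1..m+1}. upper_left m A i k * upper_left m B k j)"
        by (rule sum.cong) (use True in \<open>auto simp: upper_left_def\<close>)
      finally show ?thesis using True by (simp add: upper_left_def Unip_mult del: sum.cl_ivl_Suc)
    qed (auto simp: upper_left_def Unip_mult)
  qed
qed

lemma lower_right_hom: "lower_right m \<in> hom (Unip p (Suc m)) (Unip p m)"
proof (rule homI)
  fix A assume A: "A \<in> carrier (Unip p (Suc m))"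
  show "lower_right m A \<in> carrier (Unip p m)"
    by (rule Unip_carrierI) (use p Unip_carrierD[OF A] in \<open>auto simp: lower_right_def\<close>)
  fix B assume B: "B \<in> carrier (Unip p (Suc m))"
  show "lower_right m (A \<otimes>\<^bsub>Unip p (Suc m)\<^esub> B) = lower_right m A \<otimes>\<^bsub>Unip p m\<^esub> lower_right m B"
  proof (intro ext)
    fix i j
    show "lower_right m (A \<otimes>\<^bsub>Unip p (Suc m)\<^esub> B) i j = (lower_right m A \<otimes>\<^bsub>Unip p m\<^esub> lower_right m B) i j"
    proof (cases "i \<in> {1..m+1} \<and> j \<in> {1..m+1}")
      case True
      \<comment> \<open>The first summand contains \<open>A (Suc i) 1\<close>, an entry below the
        diagonal, so the sum may start at 2 and be shifted.\<close>
      have "(\<Sum>k\<in>{1..Suc m + 1}. A (Suc i) k * B k (Suc j)) = (\<Sum>k\<in>{Suc 1..Suc (m + 1)}. A (Suc i) k * B k (Suc j))"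
        using Unip_carrierD(4)[OF A, of 1 "Suc i"] True by (subst sum.atLeast_Suc_atMost) auto
      also have "\<dots> = (\<Sum>k\<in>{1..m+1}. A (Suc i) (Suc k) * B (Suc k) (Suc j))"
        by (rule sum.shift_bounds_cl_Suc_ivl)
      also have "\<dots> = (\<Sum>k\<in>{1..m+1}. lower_right m A i k * lower_right m B k j)"
        by (rule sum.cong) (use True in \<open>auto simp: lower_right_def\<close>)
      finally show ?thesis using True by (simp add: lower_right_def Unip_mult)
    qed (auto simp: lower_right_def Unip_mult)
  qed
qed

lemma pad_one_hom: "pad_one m \<in> hom (Unip p m) (Unip p (Suc m))"
proof (rule homI)
  fix A assume A: "A \<in> carrier (Unip p m)"
  show "pad_one m A \<in> carrier (Unip p (Suc m))"
    by (rule Unip_carrierI) (use p Unip_carrierD[OF A] in \<open>auto simp: pad_one_def\<close>)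
  fix B assume B: "B \<in> carrier (Unip p m)"
  show "pad_one m (A \<otimes>\<^bsub>Unip p m\<^esub> B) = pad_one m A \<otimes>\<^bsub>Unip p (Suc m)\<^esub> pad_one m B"
  proof (intro ext)
    fix i j
    show "pad_one m (A \<otimes>\<^bsub>Unip p m\<^esub> B) i j = (pad_one m A \<otimes>\<^bsub>Unip p (Suc m)\<^esub> pad_one m B) i j"
    proof (cases "i \<in> {1..Suc m+1} \<and> j \<in> {1..Suc m+1}")
      case True
      have "(\<Sum>k\<in>{1..Suc m + 1}. pad_one m A i k * pad_one m B k j)
          = (\<Sum>k\<in>{1..m+1}. pad_one m A i k * pad_one m B k j) + pad_one m A i (m+2) * pad_one m B (m+2) j"
        by simp
      also have "(\<Sum>k\<in>{1..m+1}. pad_one m A i k * pad_one m B k j) = (\<Sum>k\<in>{1..m+1}. A i k * B k j)"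
        by (rule sum.cong) (auto simp: pad_one_def)
      also have "pad_one m A i (m+2) * pad_one m B (m+2) j = (if i = m + 2 \<and> j = m + 2 then 1 else 0)"
        using Unip_carrierD(2)[OF A, of i "m+2"] Unip_carrierD(2)[OF B, of "m+2" j] by (auto simp: pad_one_def)
      finally have s: "(pad_one m A \<otimes>\<^bsub>Unip p (Suc m)\<^esub> pad_one m B) i j
        = ((\<Sum>k\<in>{1..m+1}. A i k * B k j) + (if i = m + 2 \<and> j = m + 2 then 1 else 0)) mod int p"
        using True by (simp add: Unip_mult)
      have z: "(\<Sum>k\<in>{1..m+1}. A i k * B k j) = 0" if "i = m + 2 \<or> j = m + 2"
        by (rule sum.neutral) (use that Unip_carrierD(2)[OF A, of i] Unip_carrierD(2)[OF B, of _ j] in auto)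
      show ?thesis
      proof (cases "i = m + 2 \<or> j = m + 2")
        case i: True
        show ?thesis unfolding s z[OF i] using i p by (auto simp: pad_one_def Unip_mult)
      next
        case False
        then show ?thesis unfolding s using True by (auto simp: pad_one_def Unip_mult)
      qed
    qed (auto simp: pad_one_def Unip_mult)
  qed
qed

lemma pad_one_eq_one:
  assumes "A \<in> carrier (Unip p m)" "pad_one m A = \<one>\<^bsub>Unip p (Suc m)\<^esub>"
  shows "A = \<one>\<^bsub>Unip p m\<^esub>"
proof (rule Unip_ext[OF assms(1) Unip_one_closed])
  fix i j assume "i \<in> {1..m+1}" "j \<in> {1..m+1}"
  then show "A i j = \<one>\<^bsub>Unip p m\<^esub> i j"
    using fun_cong[OF fun_cong[OF assms(2), of i], of j] by (auto simp: pad_one_def Unip_one split: if_splits)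
qed

text \<open>The two blocks cover every position except the two opposite corners. The lower left one
  vanishes by triangularity, the upper right one is the free parameter.\<close>

lemma blocks_trivial_imp_central:
  assumes A: "A \<in> carrier (Unip p (Suc m))"
    and ul: "upper_left m A = \<one>\<^bsub>Unip p m\<^esub>" and lr: "lower_right m A = \<one>\<^bsub>Unip p m\<^esub>"
  shows "A = Zemb (Suc m) (A 1 (Suc m + 1))"
proof (intro ext)
  fix i j
  consider "i \<notin> {1..m+2} \<or> j \<notin> {1..m+2}" | "i \<in> {1..m+1}" "j \<in> {1..m+1}"
    | "i \<in> {2..m+2}" "j \<in> {2..m+2}" | "i = 1" "j = m + 2" | "i = m + 2" "j = 1"
    by force
  then show "A i j = Zemb (Suc m) (A 1 (Suc m + 1)) i j"
  proof cases
    case 1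
    then show ?thesis using Unip_carrierD(2)[OF A, of i j] by (auto simp: Zemb_def)
  next
    case 2
    then show ?thesis using fun_cong[OF fun_cong[OF ul, of i], of j] by (auto simp: upper_left_def Unip_one Zemb_def)
  next
    case 3
    then show ?thesis using fun_cong[OF fun_cong[OF lr, of "i - 1"], of "j - 1"]
      by (cases i; cases j) (auto simp: lower_right_def Unip_one Zemb_def split: if_splits)
  next
    case 4
    then show ?thesis by (simp add: Zemb_def)
  next
    case 5
    then show ?thesis using Unip_carrierD(4)[OF A, of j i] by (auto simp: Zemb_def)
  qed
qed

end

section \<open>Splittings of inflated cocycles\<close>

text \<open>\<open>m\<close> stands for n - 1, which removes subtraction from the indices and turns
  n >= 2 into \<open>1 \<le> m\<close>.\<close>

locale massey =
  fixes G :: "('g, 'b) monoid_scheme" (structure) and \<tau> :: "'g topology" and p m :: nat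
  assumes prime_p: "Factorial_Ring.prime p" and m_pos: "1 \<le> m" and profinite: "profinite_group G \<tau>"

sublocale massey \<subseteq> topological_group G \<tau>
  using profinite by (auto simp: profinite_group_def topological_group_def topological_group_axioms_def)

context massey
begin

lemma p_gt_1: "1 < p" by (rule prime_gt_1_nat[OF prime_p])

abbreviation "U k \<equiv> Unip p k"
abbreviation "uhoms k \<equiv> chom G \<tau> (U k) (discrete_topology (carrier (U k)))"
abbreviation "T k \<equiv> Tn G \<tau> p k"
abbreviation "N \<equiv> T m"
abbreviation "M \<equiv> T (Suc m)"
abbreviation "Gbar \<equiv> Gq G \<tau> p m"
abbreviation "\<tau>bar \<equiv> \<tau>q G \<tau> p m"
abbreviation "values \<equiv> discrete_topology {0..<int p}"

section \<open>The subgroups N and M\<close>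

lemma uhomsD:
  assumes "\<rho> \<in> uhoms k"
  shows "x \<in> carrier G \<Longrightarrow> \<rho> x \<in> carrier (U k)"
    and "x \<in> carrier G \<Longrightarrow> y \<in> carrier G \<Longrightarrow> \<rho> (x \<otimes> y) = \<rho> x \<otimes>\<^bsub>U k\<^esub> \<rho> y"
    and "continuous_map \<tau> (discrete_topology (carrier (U k))) \<rho>"
    and "group_hom G (U k) \<rho>"
  using assms group_Unip[OF p_gt_1, of k] is_group
  by (auto simp: chom_def hom_def group_hom_def group_hom_axioms_def)

lemma uhoms_comp:
  assumes "\<rho> \<in> uhoms k" "f \<in> hom (U k) (U l)"
  shows "f \<circ> \<rho> \<in> uhoms l"
proof -
  have "f \<circ> \<rho> \<in> hom G (U l)" using assms by (simp add: chom_def Group.hom_compose[where I = "U l" and H = "U k"])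
  moreover have "continuous_map \<tau> (discrete_topology (carrier (U l))) (f \<circ> \<rho>)"
    by (rule continuous_map_compose[OF uhomsD(3)[OF assms(1)]]) (use assms(2) in \<open>auto simp: hom_def\<close>)
  ultimately show ?thesis by (simp add: chom_def)
qed

lemma T_iff: "x \<in> T k \<longleftrightarrow> x \<in> carrier G \<and> (\<forall>\<rho>\<in>uhoms k. \<rho> x = \<one>\<^bsub>U k\<^esub>)"
  by (auto simp: Tn_def TU_def kernel_def)

lemma normal_T: "T k \<lhd> G"
proof -
  have "subgroup (T k) G"
  proof (rule subgroupI)
    have "\<one> \<in> T k" unfolding T_iff using group_hom.hom_one[OF uhomsD(4)] by blast
    then show "T k \<noteq> {}" by blast
    show "T k \<subseteq> carrier G" using T_iff by blast
  next
    fix a assume "a \<in> T k"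
    then show "inv a \<in> T k"
      using group_hom.hom_inv[OF uhomsD(4)] group.is_monoid[OF group_Unip[OF p_gt_1]] by (simp add: T_iff monoid.inv_one)
  next
    fix a b assume "a \<in> T k" "b \<in> T k"
    then show "a \<otimes> b \<in> T k"
      using uhomsD(2) Unip_l_one[OF p_gt_1 Unip_one_closed[OF p_gt_1]] by (simp add: T_iff)
  qed
  moreover have "x \<otimes> h \<otimes> inv x \<in> T k" if x: "x \<in> carrier G" and h: "h \<in> T k" for x h
    unfolding T_iff
  proof (intro conjI ballI)
    show "x \<otimes> h \<otimes> inv x \<in> carrier G" using x h T_iff by simp
    fix \<rho> assume \<rho>: "\<rho> \<in> uhoms k"
    interpret \<rho>: group_hom G "U k" \<rho> by (rule uhomsD(4)[OF \<rho>])
    have "h \<in> carrier G" "\<rho> h = \<one>\<^bsub>U k\<^esub>" using h \<rho> T_iff by auto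
    then show "\<rho> (x \<otimes> h \<otimes> inv x) = \<one>\<^bsub>U k\<^esub>" using x by simp
  qed
  ultimately show ?thesis using normal_inv_iff by blast
qed

lemma T_subset: "T k \<subseteq> carrier G" using T_iff by blast

text \<open>Being closed in the compact group G makes N compact; this is the source of the
  compactness of N/M.\<close>

lemma closedin_T: "closedin \<tau> (T k)"
proof -
  have "closedin \<tau> {x \<in> topspace \<tau>. \<rho> x \<in> {\<one>\<^bsub>U k\<^esub>}}" if "\<rho> \<in> uhoms k" for \<rho>
    by (rule closedin_continuous_map_preimage[OF uhomsD(3)[OF that]]) (use Unip_one_closed[OF p_gt_1] in auto)
  moreover have "T k = topspace \<tau> \<inter> (\<Inter>\<rho>\<in>uhoms k. {x \<in> topspace \<tau>. \<rho> x \<in> {\<one>\<^bsub>U k\<^esub>}})"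
    using T_iff topspace_eq by auto
  ultimately show ?thesis by (cases "uhoms k = {}") (auto intro!: closedin_Int closedin_Inter)
qed

lemma M_subset_N: "M \<subseteq> N"
proof
  fix x assume x: "x \<in> M"
  then have xG: "x \<in> carrier G" by (simp add: T_iff)
  show "x \<in> N"
    unfolding T_iff
  proof (intro conjI ballI xG)
    fix \<rho> assume \<rho>: "\<rho> \<in> uhoms m"
    have "(pad_one m \<circ> \<rho>) x = \<one>\<^bsub>U (Suc m)\<^esub>"
      using x uhoms_comp[OF \<rho> pad_one_hom[OF p_gt_1]] unfolding T_iff by blast
    then show "\<rho> x = \<one>\<^bsub>U m\<^esub>"
      using pad_one_eq_one[OF p_gt_1 uhomsD(1)[OF \<rho> xG]] by simp
  qed
qed

text \<open>Composed with either block map, \<open>\<rho>\<close> becomes a homomorphism to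
  \<open>U m\<close> and hence dies on N, so only the corner of \<open>\<rho> x\<close>
  survives.\<close>

lemma uhom_central_on_N:
  assumes \<rho>: "\<rho> \<in> uhoms (Suc m)" and x: "x \<in> N"
  shows "\<rho> x = Zemb (Suc m) (\<rho> x 1 (Suc m + 1))"
proof (rule blocks_trivial_imp_central[OF p_gt_1 uhomsD(1)[OF \<rho>]])
  show "x \<in> carrier G" using x T_iff by blast
  show "upper_left m (\<rho> x) = \<one>\<^bsub>U m\<^esub>"
    using x uhoms_comp[OF \<rho> upper_left_hom[OF p_gt_1]] by (fastforce simp: T_iff)
  show "lower_right m (\<rho> x) = \<one>\<^bsub>U m\<^esub>"
    using x uhoms_comp[OF \<rho> lower_right_hom[OF p_gt_1]] by (fastforce simp: T_iff)
qed

text \<open>The group of order \<open>p\<close> embeds into \<open>U m\<close>, so continuous characters of \<open>G\<close> vanish on \<open>N\<close>.\<close>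
lemma character_trivial_on_N:
  assumes c: "continuous_map \<tau> values \<phi>"
    and hom: "\<And>x y. x \<in> carrier G \<Longrightarrow> y \<in> carrier G \<Longrightarrow> [\<phi> (x \<otimes> y) = \<phi> x + \<phi> y] (mod int p)"
    and x: "x \<in> N"
  shows "\<phi> x = 0"
proof -
  have R: "\<phi> y \<in> {0..<int p}" if "y \<in> carrier G" for y
    using c that topspace_eq by (fastforce simp: continuous_map_def Pi_iff)
  have "(\<lambda>y. Zemb m (\<phi> y)) \<in> uhoms m"
    unfolding chom_def
  proof (intro CollectI conjI homI)
    fix y z assume y: "y \<in> carrier G" and z: "z \<in> carrier G"
    have "\<phi> (y \<otimes> z) = (\<phi> y + \<phi> z) mod int p"
      using hom[OF y z] R[of "y \<otimes> z"] y z by (simp add: cong_def)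
    then show "Zemb m (\<phi> (y \<otimes> z)) = Zemb m (\<phi> y) \<otimes>\<^bsub>U m\<^esub> Zemb m (\<phi> z)"
      using Zemb_add[OF p_gt_1 m_pos R[OF y] R[OF z]] by simp
  qed (use Zemb_closed[OF p_gt_1 m_pos] R topspace_eq in \<open>auto intro!: continuous_map_discrete_unop[OF c]\<close>)
  moreover have "\<forall>\<rho>\<in>uhoms m. \<rho> x = \<one>\<^bsub>U m\<^esub>" using x by (simp add: T_iff)
  ultimately have "Zemb m (\<phi> x) = \<one>\<^bsub>U m\<^esub>" by (rule bspec[rotated])
  from fun_cong[OF fun_cong[OF this, of 1], of "m + 1"] show ?thesis
    using m_pos by (simp add: Zemb_def Unip_one)
qed

section \<open>Cosets and functions on the quotients\<close>

lemma cochains_Gq: "cochains (Gq G \<tau> p k) (\<tau>q G \<tau> p k) p"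
  unfolding cochains_def cochains_axioms_def Gq_def \<tau>q_def
  using topological_group_Mod[OF normal_T] p_gt_1 by auto

interpretation NG: normal N G by (rule normal_T)
interpretation MG: normal M G by (rule normal_T)
interpretation C: cochains Gbar \<tau>bar p by (rule cochains_Gq)
interpretation CM: cochains "Gq G \<tau> p (Suc m)" "\<tau>q G \<tau> p (Suc m)" p by (rule cochains_Gq)

lemma coset_left_mult:
  assumes u: "u \<in> T k" and x: "x \<in> carrier G"
  shows "T k #> (u \<otimes> x) = T k #> x"
proof -
  interpret normal "T k" G by (rule normal_T)
  have uG: "u \<in> carrier G" using u T_subset by blast
  show ?thesis
    using coset_mult_assoc[OF T_subset[of k] uG x] coset_join2[OF uG subgroup_axioms u] by simp
qed

lemma carrier_Gbar: "carrier Gbar = (\<lambda>x. N #> x) ` carrier G"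
  by (simp add: Gq_def carrier_FactGroup)

lemma Gbar_mem: "x \<in> carrier G \<Longrightarrow> N #> x \<in> carrier Gbar"
  by (simp add: carrier_Gbar)

lemma Gbar_mult: "x \<in> carrier G \<Longrightarrow> y \<in> carrier G \<Longrightarrow> (N #> x) \<otimes>\<^bsub>Gbar\<^esub> (N #> y) = N #> (x \<otimes> y)"
  by (simp add: Gq_def NG.rcos_sum)

text \<open>Both \<open>descend\<close> and the pairing evaluate a function at a point of a coset
  picked by \<open>SOME\<close>; left invariance makes the choice irrelevant.\<close>

lemma coset_representative:
  assumes "\<And>u x. u \<in> T k \<Longrightarrow> x \<in> carrier G \<Longrightarrow> f (u \<otimes> x) = f x" "x \<in> carrier G"
  shows "f (SOME y. y \<in> T k #> x) = f x"
proof -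
  interpret normal "T k" G by (rule normal_T)
  have "\<exists>y. y \<in> T k #> x" using rcos_self[OF assms(2) subgroup_axioms] by blast
  then have "(SOME y. y \<in> T k #> x) \<in> T k #> x" by (rule someI_ex)
  then obtain u where "u \<in> T k" "(SOME y. y \<in> T k #> x) = u \<otimes> x" by (auto simp: r_coset_def)
  then show ?thesis using assms by simp
qed

lemma descend:
  assumes c: "continuous_map \<tau> \<upsilon> f" and inv: "\<And>u x. u \<in> T k \<Longrightarrow> x \<in> carrier G \<Longrightarrow> f (u \<otimes> x) = f x"
  obtains l where "continuous_map (\<tau>q G \<tau> p k) \<upsilon> l" "\<And>x. x \<in> carrier G \<Longrightarrow> l (T k #> x) = f x"
proof
  let ?l = "\<lambda>C. f (SOME y. y \<in> C)"
  show l: "?l (T k #> x) = f x" if "x \<in> carrier G" for x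
    by (rule coset_representative[OF inv that])
  show "continuous_map (\<tau>q G \<tau> p k) \<upsilon> ?l"
    unfolding \<tau>q_def by (rule continuous_map_from_qtop[OF c]) (use l topspace_eq in auto)
qed

lemma N_mult_coset:
  assumes x: "x \<in> carrier G"
  shows "N <#> (M #> x) = N #> x"
proof -
  have "N <#> M = N"
  proof
    show "N <#> M \<subseteq> N" using M_subset_N NG.m_closed by (auto simp: set_mult_def)
    show "N \<subseteq> N <#> M"
    proof
      fix a assume "a \<in> N"
      then have "a = a \<otimes> \<one>" using T_subset[of m] by auto
      with \<open>a \<in> N\<close> show "a \<in> N <#> M" using MG.one_closed unfolding set_mult_def by blast
    qed
  qed
  then show ?thesis using setmult_rcos_assoc[OF T_subset T_subset x] by simp
qed

section \<open>Inflation from G/N to G/M\<close>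

lemma infl_chom: "(\<lambda>C. N <#> C) \<in> chom (Gq G \<tau> p (Suc m)) (\<tau>q G \<tau> p (Suc m)) Gbar \<tau>bar"
  unfolding chom_def
proof (intro CollectI conjI homI)
  fix C D assume "C \<in> carrier (Gq G \<tau> p (Suc m))" "D \<in> carrier (Gq G \<tau> p (Suc m))"
  then obtain x y where x: "x \<in> carrier G" "C = M #> x" and y: "y \<in> carrier G" "D = M #> y"
    by (auto simp: Gq_def carrier_FactGroup)
  show "N <#> C \<in> carrier Gbar" using x by (simp add: N_mult_coset Gbar_mem)
  show "N <#> (C \<otimes>\<^bsub>Gq G \<tau> p (Suc m)\<^esub> D) = (N <#> C) \<otimes>\<^bsub>Gbar\<^esub> (N <#> D)"
    using x y by (simp add: Gq_def MG.rcos_sum NG.rcos_sum N_mult_coset)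
next
  show "continuous_map (\<tau>q G \<tau> p (Suc m)) \<tau>bar (\<lambda>C. N <#> C)"
    unfolding \<tau>q_def
    by (rule continuous_map_from_qtop[OF continuous_map_qtop]) (simp add: N_mult_coset topspace_eq)
qed

lemma infl_cls: "f \<in> Z2 Gbar \<tau>bar p \<Longrightarrow> infl G \<tau> p (Suc m) (C.cls f)
    = CM.cls (pull2 (Gq G \<tau> p (Suc m)) (\<lambda>C. N <#> C) f)"
  using H2_pull_coset[OF cochains_Gq cochains_Gq infl_chom] by (simp add: infl_def)

lemma infl_hom: "infl G \<tau> p (Suc m) \<in> hom C.H CM.H"
  using H2_pull_hom[OF cochains_Gq cochains_Gq infl_chom] by (simp add: infl_def)

text \<open>The inflation of \<open>f\<close> to \<open>G\<close> is the coboundary of \<open>h\<close>, and \<open>h\<close> descends to \<open>G/M\<close>.\<close>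
definition splits :: "('g set \<Rightarrow> 'g set \<Rightarrow> int) \<Rightarrow> ('g \<Rightarrow> int) \<Rightarrow> bool" where
  "splits f h \<longleftrightarrow> continuous_map \<tau> values h
     \<and> (\<forall>x\<in>carrier G. \<forall>y\<in>carrier G. [f (N #> x) (N #> y) = h y - h (x \<otimes> y) + h x] (mod int p))
     \<and> (\<forall>u\<in>M. \<forall>x\<in>carrier G. h (u \<otimes> x) = h x)"

text \<open>Cocycles are not normalised: the splitting relation at the identity says f(1,1) = h(1),
  which may be nonzero. Subtracting \<open>h \<one>\<close> makes the function additive on
  N.\<close>

definition chr :: "('g \<Rightarrow> int) \<Rightarrow> 'g \<Rightarrow> int" where
  "chr h x = (h x - h \<one>) mod int p"

lemma splitsD:
  assumes "splits f h"
  shows "continuous_map \<tau> values h"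
    and "x \<in> carrier G \<Longrightarrow> y \<in> carrier G \<Longrightarrow> [f (N #> x) (N #> y) = h y - h (x \<otimes> y) + h x] (mod int p)"
    and "u \<in> M \<Longrightarrow> x \<in> carrier G \<Longrightarrow> h (u \<otimes> x) = h x"
  using assms by (auto simp: splits_def)

text \<open>Cochains are transported along G -> G/M in both directions: upwards by composition,
  downwards by \<open>descend\<close>, for which \<open>splits\<close> demands invariance under
  M.\<close>

lemma infl_trivial_iff:
  assumes f: "f \<in> Z2 Gbar \<tau>bar p"
  shows "infl G \<tau> p (Suc m) (C.cls f) = \<one>\<^bsub>CM.H\<^esub> \<longleftrightarrow> (\<exists>h. splits f h)"
proof -
  let ?GM = "Gq G \<tau> p (Suc m)"
  let ?g = "pull2 ?GM (\<lambda>C. N <#> C) f"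
  have g: "?g \<in> Z2 ?GM (\<tau>q G \<tau> p (Suc m)) p"
    by (rule pull2_Z2[OF cochains_Gq cochains_Gq infl_chom f])
  have mem: "M #> x \<in> carrier ?GM" if "x \<in> carrier G" for x
    using that by (simp add: Gq_def carrier_FactGroup)
  have mult: "(M #> x) \<otimes>\<^bsub>?GM\<^esub> (M #> y) = M #> (x \<otimes> y)" if "x \<in> carrier G" "y \<in> carrier G" for x y
    using that by (simp add: Gq_def MG.rcos_sum)
  have ge: "?g (M #> x) (M #> y) = f (N #> x) (N #> y)" if "x \<in> carrier G" "y \<in> carrier G" for x y
    using that by (simp add: pull2_def mem N_mult_coset)
  show ?thesis
  proof
    assume "infl G \<tau> p (Suc m) (C.cls f) = \<one>\<^bsub>CM.H\<^esub>"
    then have "CM.cls ?g = CM.cls (\<lambda>x y. 0)" using infl_cls[OF f] CM.cls_zero by simp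
    from CM.cls_eqD[OF g this] obtain k where k: "continuous_map (\<tau>q G \<tau> p (Suc m)) values k"
      "\<And>x y. x \<in> carrier ?GM \<Longrightarrow> y \<in> carrier ?GM \<Longrightarrow> [?g x y = k y - k (x \<otimes>\<^bsub>?GM\<^esub> y) + k x] (mod int p)"
      by auto
    have "continuous_map \<tau> values (k \<circ> (\<lambda>x. M #> x))"
      by (rule continuous_map_compose[OF continuous_map_qtop]) (use k in \<open>simp add: \<tau>q_def\<close>)
    then have "splits f (\<lambda>x. k (M #> x))"
      using k(2)[OF mem mem] by (auto simp: splits_def o_def ge mult coset_left_mult)
    then show "\<exists>h. splits f h" by blast
  next
    assume "\<exists>h. splits f h"
    then obtain h where h: "splits f h" by blast
    obtain l where l: "continuous_map (\<tau>q G \<tau> p (Suc m)) values l" "\<And>x. x \<in> carrier G \<Longrightarrow> l (M #> x) = h x"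
      using descend[OF splitsD(1,3)[OF h]] by blast
    have "CM.cls ?g = CM.cls (\<lambda>x y. 0)"
    proof (rule CM.cls_eqI[OF g CM.Z2_zero l(1)])
      fix x y assume "x \<in> carrier ?GM" "y \<in> carrier ?GM"
      then obtain x' y' where "x' \<in> carrier G" "x = M #> x'" "y' \<in> carrier G" "y = M #> y'"
        by (auto simp: Gq_def carrier_FactGroup)
      then show "[?g x y = 0 + (l y - l (x \<otimes>\<^bsub>?GM\<^esub> y) + l x)] (mod int p)"
        using splitsD(2)[OF h] by (simp add: ge mult l(2))
    qed
    then show "infl G \<tau> p (Suc m) (C.cls f) = \<one>\<^bsub>CM.H\<^esub>" using infl_cls[OF f] CM.cls_zero by simp
  qed
qed

text \<open>The cocycle \<open>f\<close> sees only cosets of N and cannot tell \<open>u\<close> from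
  \<open>\<one>\<close>, so its splitting relations at (u,x) and (1,x) can be equated.\<close>

lemma splits_left_mult:
  assumes h: "splits f h" and u: "u \<in> N" and x: "x \<in> carrier G"
  shows "[h (u \<otimes> x) = h x + h u - h \<one>] (mod int p)"
proof -
  have uG: "u \<in> carrier G" using u T_subset by blast
  have "N #> u = N #> \<one>" using coset_left_mult[OF u one_closed] uG by simp
  then have "[h x - h (u \<otimes> x) + h u = h x - h x + h \<one>] (mod int p)"
    using splitsD(2)[OF h uG x] splitsD(2)[OF h one_closed x] x by (metis cong_sym cong_trans l_one)
  then show ?thesis
    by (rule cong_linear_combination[OF _ cong_refl cong_refl cong_refl, where q = "-1" and r = 0 and s = 0 and t = 0]) simp
qed

lemma chr_cong: "[chr h x = h x - h \<one>] (mod int p)"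
  by (simp add: chr_def)

lemma chr_mult:
  assumes h: "splits f h" and u: "u \<in> N" and x: "x \<in> carrier G"
  shows "[chr h (u \<otimes> x) = chr h u + chr h x] (mod int p)"
  by (rule cong_linear_combination[OF splits_left_mult[OF assms] chr_cong[of h "u \<otimes> x"] chr_cong[of h u] chr_cong[of h x],
        where q = 1 and r = 1 and s = "-1" and t = "-1"]) simp

lemma chr_M:
  assumes h: "splits f h" and u: "u \<in> M" and x: "x \<in> carrier G"
  shows "chr h (u \<otimes> x) = chr h x"
  using splitsD(3)[OF assms] by (simp add: chr_def)

lemma chr_continuous:
  assumes "splits f h"
  shows "continuous_map \<tau> values (chr h)"
  unfolding chr_def[abs_def]
  by (rule continuous_map_discrete_unop[OF splitsD(1)[OF assms]]) (use p_gt_1 in auto)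

text \<open>The difference of two splittings of cohomologous cocycles is, up to a function on \<open>G/N\<close>,
  a character of \<open>G\<close>.\<close>
lemma chr_unique:
  assumes f: "f \<in> Z2 Gbar \<tau>bar p" and eq: "C.cls f = C.cls g" and h: "splits f h" and k: "splits g k" and x: "x \<in> N"
  shows "chr h x = chr k x"
proof -
  obtain l where l: "continuous_map \<tau>bar values l"
    "\<And>x y. x \<in> carrier Gbar \<Longrightarrow> y \<in> carrier Gbar \<Longrightarrow> [f x y = g x y + (l y - l (x \<otimes>\<^bsub>Gbar\<^esub> y) + l x)] (mod int p)"
    using C.cls_eqD[OF f eq] by blast
  \<comment> \<open>The coboundary of \<open>l\<close> is f - g on G/N, so the pullback of
    \<open>l\<close> accounts for the whole coboundary of h - k.\<close>
  define \<phi> where "\<phi> y = (((h y - k y) mod int p) - l (N #> y)) mod int p" for y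
  have lc: "continuous_map \<tau> values (\<lambda>y. l (N #> y))"
    using continuous_map_compose[OF continuous_map_qtop l(1)[unfolded \<tau>q_def]] by (simp add: o_def)
  have "continuous_map \<tau> values (\<lambda>y. (h y - k y) mod int p)"
    by (rule continuous_map_discrete_binop[OF splitsD(1)[OF h] splitsD(1)[OF k]]) (use p_gt_1 in auto)
  then have \<phi>c: "continuous_map \<tau> values \<phi>"
    unfolding \<phi>_def by (rule continuous_map_discrete_binop[OF _ lc]) (use p_gt_1 in auto)
  have \<phi>: "[\<phi> y = h y - k y - l (N #> y)] (mod int p)" for y
    by (simp add: \<phi>_def cong_def mod_diff_left_eq)
  have \<phi>0: "\<phi> y = 0" if "y \<in> N" for y
  proof (rule character_trivial_on_N[OF \<phi>c _ that])
    fix y z assume yz: "y \<in> carrier G" "z \<in> carrier G"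
    have "[f (N #> y) (N #> z) = g (N #> y) (N #> z) + (l (N #> z) - l (N #> (y \<otimes> z)) + l (N #> y))] (mod int p)"
      using l(2)[OF Gbar_mem[OF yz(1)] Gbar_mem[OF yz(2)]] yz by (simp add: Gbar_mult)
    note a = this splitsD(2)[OF h yz] splitsD(2)[OF k yz]
    have "[(h (y \<otimes> z) - k (y \<otimes> z) - l (N #> (y \<otimes> z))) = (h y - k y - l (N #> y)) + (h z - k z - l (N #> z))] (mod int p)"
      by (rule cong_linear_combination[OF a cong_refl, where q = "-1" and r = 1 and s = "-1" and t = 0]) simp
    then show "[\<phi> (y \<otimes> z) = \<phi> y + \<phi> z] (mod int p)"
      by (rule cong_linear_combination[OF _ \<phi>[of "y \<otimes> z"] \<phi>[of y] \<phi>[of z],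
            where q = 1 and r = 1 and s = "-1" and t = "-1"]) simp
  qed
  have "N #> x = N #> \<one>" using coset_left_mult[OF x one_closed] T_subset x by (metis r_one subsetD)
  \<comment> \<open>\<open>\<phi>\<close> vanishes at both \<open>x\<close> and
    \<open>\<one>\<close>, and the pullback of \<open>l\<close> takes the same value at the two
    points; comparing the relations eliminates \<open>l\<close>.\<close>
  then have "[0 = h x - k x - l (N #> \<one>)] (mod int p)" "[0 = h \<one> - k \<one> - l (N #> \<one>)] (mod int p)"
    using \<phi>[of x] \<phi>[of \<one>] \<phi>0[OF x] \<phi>0[OF NG.one_closed] by simp_all
  then have "[h x - h \<one> = k x - k \<one>] (mod int p)"
    by (rule cong_linear_combination[OF _ _ cong_refl cong_refl, where q = "-1" and r = 1 and s = 0 and t = 0]) simp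
  then show ?thesis by (simp add: chr_def cong_def)
qed

text \<open>By \<open>splits_left_mult\<close>, equality of the characters on N means that h - k is
  invariant modulo \<open>p\<close> under left multiplication by N. The function it induces on G/N
  cobounds f - g.\<close>

lemma cls_eq_if_chr_eq:
  assumes f: "f \<in> Z2 Gbar \<tau>bar p" and g: "g \<in> Z2 Gbar \<tau>bar p" and h: "splits f h" and k: "splits g k"
    and eq: "\<And>x. x \<in> N \<Longrightarrow> chr h x = chr k x"
  shows "C.cls f = C.cls g"
proof -
  have c: "continuous_map \<tau> values (\<lambda>y. (h y - k y) mod int p)"
    by (rule continuous_map_discrete_binop[OF splitsD(1)[OF h] splitsD(1)[OF k]]) (use p_gt_1 in auto)
  have inv: "(h (u \<otimes> x) - k (u \<otimes> x)) mod int p = (h x - k x) mod int p" if u: "u \<in> N" and x: "x \<in> carrier G" for u x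
  proof -
    have "[h u - h \<one> = k u - k \<one>] (mod int p)" using eq[OF u] by (simp add: chr_def cong_def)
    then have "[h (u \<otimes> x) - k (u \<otimes> x) = h x - k x] (mod int p)"
      by (rule cong_linear_combination[OF splits_left_mult[OF h u x] splits_left_mult[OF k u x] _ cong_refl,
            where q = 1 and r = "-1" and s = 1 and t = 0]) simp
    then show ?thesis by (simp add: cong_def)
  qed
  obtain l where l: "continuous_map \<tau>bar values l" "\<And>x. x \<in> carrier G \<Longrightarrow> l (N #> x) = (h x - k x) mod int p"
    using descend[OF c inv] by blast
  show ?thesis
  proof (rule C.cls_eqI[OF f g l(1)])
    fix x y assume "x \<in> carrier Gbar" "y \<in> carrier Gbar"
    then obtain x' y' where x: "x' \<in> carrier G" "x = N #> x'" and y: "y' \<in> carrier G" "y = N #> y'"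
      by (auto simp: carrier_Gbar)
    let ?d = "\<lambda>x. h x - k x"
    have "[f x y = g x y + (?d y' - ?d (x' \<otimes> y') + ?d x')] (mod int p)"
      unfolding x y
      by (rule cong_linear_combination[OF splitsD(2)[OF h x(1) y(1)] splitsD(2)[OF k x(1) y(1)] cong_refl cong_refl,
            where q = 1 and r = "-1" and s = 0 and t = 0]) simp
    moreover have "[g x y + (?d y' - ?d (x' \<otimes> y') + ?d x') = g x y + (l y - l (x \<otimes>\<^bsub>Gbar\<^esub> y) + l x)] (mod int p)"
      using x y by (simp add: Gbar_mult l(2)) (intro cong_add cong_diff cong_refl; simp add: cong_def)
    ultimately show "[f x y = g x y + (l y - l (x \<otimes>\<^bsub>Gbar\<^esub> y) + l x)] (mod int p)" by (rule cong_trans)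
  qed
qed

lemma splits_add:
  assumes h: "splits f h" and k: "splits g k"
  shows "splits (\<lambda>x y. (f x y + g x y) mod int p) (\<lambda>x. (h x + k x) mod int p)"
  unfolding splits_def
proof (intro conjI ballI)
  show "continuous_map \<tau> values (\<lambda>x. (h x + k x) mod int p)"
    by (rule continuous_map_discrete_binop[OF splitsD(1)[OF h] splitsD(1)[OF k]]) (use p_gt_1 in auto)
next
  fix x y assume xy: "x \<in> carrier G" "y \<in> carrier G"
  let ?s = "\<lambda>x. h x + k x"
  have "[f (N #> x) (N #> y) + g (N #> x) (N #> y) = ?s y - ?s (x \<otimes> y) + ?s x] (mod int p)"
    by (rule cong_linear_combination[OF splitsD(2)[OF h xy] splitsD(2)[OF k xy] cong_refl cong_refl,
          where q = 1 and r = 1 and s = 0 and t = 0]) simp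
  moreover have "[?s y mod int p - ?s (x \<otimes> y) mod int p + ?s x mod int p = ?s y - ?s (x \<otimes> y) + ?s x] (mod int p)"
    by (intro cong_add cong_diff) simp_all
  ultimately show "[(f (N #> x) (N #> y) + g (N #> x) (N #> y)) mod int p
      = ?s y mod int p - ?s (x \<otimes> y) mod int p + ?s x mod int p] (mod int p)"
    by (simp add: cong_def)
qed (use splitsD(3)[OF h] splitsD(3)[OF k] in auto)

lemma chr_add: "[chr (\<lambda>x. (h x + k x) mod int p) x = chr h x + chr k x] (mod int p)"
proof -
  have "[chr (\<lambda>x. (h x + k x) mod int p) x = (h x + k x) - (h \<one> + k \<one>)] (mod int p)"
    by (simp add: chr_def cong_def mod_diff_eq)
  then show ?thesis
    by (rule cong_linear_combination[OF _ chr_cong[of h x] chr_cong[of k x] cong_refl,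
          where q = 1 and r = "-1" and s = "-1" and t = 0]) simp
qed

lemma uhom_T: "x \<in> T k \<Longrightarrow> \<rho> \<in> uhoms k \<Longrightarrow> \<rho> x = \<one>\<^bsub>U k\<^esub>"
  by (drule iffD1[OF T_iff]) (erule bspec[OF conjunct2])

section \<open>The pairing with the Massey classes\<close>

abbreviation "dUbar \<equiv> discrete_topology (carrier (Ubar p (Suc m)))"

lemma cochains_Ubar: "cochains (Ubar p (Suc m)) dUbar p"
proof -
  interpret Ub: group "Ubar p (Suc m)" by (rule group_Ubar[OF p_gt_1]) simp
  show ?thesis
    using p_gt_1 Ub.is_group
    by (auto simp: cochains_def cochains_axioms_def topological_group_def topological_group_axioms_def
        simp flip: prod_topology_discrete_topology)
qed

text \<open>\<open>lam\<close> is onto, so the cocycle identity may be checked over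
  \<open>U (Suc m)\<close>, where the cocycle is the coboundary of \<open>sec_corner\<close> and the
  terms cancel by associativity.\<close>

lemma alpha_cocycle_Z2: "alpha_cocycle p (Suc m) \<in> Z2 (Ubar p (Suc m)) dUbar p"
proof -
  interpret Ub: cochains "Ubar p (Suc m)" dUbar p by (rule cochains_Ubar)
  have n: "1 \<le> Suc m" by simp
  note al = alpha_cocycle_lam[OF p_gt_1 n]
  interpret U: group "U (Suc m)" by (rule group_Unip[OF p_gt_1])
  show ?thesis
  proof (rule Ub.Z2I)
    show "continuous_map (prod_topology dUbar dUbar) (discrete_topology {0..<int p}) (\<lambda>(x, y). alpha_cocycle p (Suc m) x y)"
      using p_gt_1 by (auto simp: carrier_Ubar[OF p_gt_1] al simp flip: prod_topology_discrete_topology)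
  next
    fix x y z assume "x \<in> carrier (Ubar p (Suc m))" "y \<in> carrier (Ubar p (Suc m))" "z \<in> carrier (Ubar p (Suc m))"
    then obtain A B D where A: "A \<in> carrier (U (Suc m))" "x = lam p (Suc m) A"
      and B: "B \<in> carrier (U (Suc m))" "y = lam p (Suc m) B" and D: "D \<in> carrier (U (Suc m))" "z = lam p (Suc m) D"
      by (auto simp: carrier_Ubar[OF p_gt_1])
    show "[alpha_cocycle p (Suc m) y z - alpha_cocycle p (Suc m) (x \<otimes>\<^bsub>Ubar p (Suc m)\<^esub> y) z
      + alpha_cocycle p (Suc m) x (y \<otimes>\<^bsub>Ubar p (Suc m)\<^esub> z) - alpha_cocycle p (Suc m) x y = 0] (mod int p)"
      using A B D by (simp add: lam_mult[OF p_gt_1 n] al U.m_assoc cong_trans[OF cong_mod_alternating])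
  qed (auto simp: alpha_cocycle_def)
qed

lemma H2_pull_alpha:
  assumes \<rho>: "\<rho> \<in> uhoms (Suc m)" and \<rho>b: "\<rho>b \<in> chom Gbar \<tau>bar (Ubar p (Suc m)) dUbar"
    and lift: "\<And>x. x \<in> carrier G \<Longrightarrow> lam p (Suc m) (\<rho> x) = \<rho>b (N #> x)"
  obtains f h where "f \<in> Z2 Gbar \<tau>bar p" "H2_pull Gbar \<tau>bar p \<rho>b (alpha p (Suc m)) = C.cls f" "splits f h"
    "\<And>x. x \<in> N \<Longrightarrow> chr h x = (- \<rho> x 1 (Suc m + 1)) mod int p"
proof
  let ?f = "pull2 Gbar \<rho>b (alpha_cocycle p (Suc m))" and ?h = "\<lambda>x. sec_corner p (Suc m) (\<rho> x)"
  show "?f \<in> Z2 Gbar \<tau>bar p" by (rule pull2_Z2[OF cochains_Ubar cochains_Gq \<rho>b alpha_cocycle_Z2])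
  show "H2_pull Gbar \<tau>bar p \<rho>b (alpha p (Suc m)) = C.cls ?f"
    unfolding alpha_def by (rule H2_pull_coset[OF cochains_Ubar cochains_Gq \<rho>b alpha_cocycle_Z2])
  have R: "sec_corner p (Suc m) A \<in> {0..<int p}" for A
    using p_gt_1 by (simp add: sec_corner_def[OF p_gt_1])
  have n: "1 \<le> Suc m" by simp
  show "splits ?f ?h"
    unfolding splits_def
  proof (intro conjI ballI)
    show "continuous_map \<tau> values ?h"
      by (rule continuous_map_discrete_unop[OF uhomsD(3)[OF \<rho>] R])
  next
    fix x y assume x: "x \<in> carrier G" and y: "y \<in> carrier G"
    have "?f (N #> x) (N #> y) = alpha_cocycle p (Suc m) (lam p (Suc m) (\<rho> x)) (lam p (Suc m) (\<rho> y))"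
      using x y by (simp add: pull2_def Gbar_mem lift)
    also have "\<dots> = (?h y - ?h (x \<otimes> y) + ?h x) mod int p"
      using alpha_cocycle_lam[OF p_gt_1 n uhomsD(1)[OF \<rho> x] uhomsD(1)[OF \<rho> y]] uhomsD(2)[OF \<rho> x y] by simp
    finally show "[?f (N #> x) (N #> y) = ?h y - ?h (x \<otimes> y) + ?h x] (mod int p)" by (simp add: cong_def)
  next
    fix u x assume u: "u \<in> M" and x: "x \<in> carrier G"
    have "u \<in> carrier G" using u T_subset by blast
    moreover have "\<rho> u = \<one>\<^bsub>U (Suc m)\<^esub>" using u \<rho> by (rule uhom_T)
    ultimately have "\<rho> (u \<otimes> x) = \<rho> x"
      using uhomsD(2)[OF \<rho> _ x] Unip_l_one[OF p_gt_1 uhomsD(1)[OF \<rho> x]] by simp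
    then show "?h (u \<otimes> x) = ?h x" by simp
  qed
  fix x assume x: "x \<in> N"
  then have xG: "x \<in> carrier G" using T_subset by blast
  have "N #> x = N #> \<one>" using coset_left_mult[OF x one_closed] xG by simp
  \<comment> \<open>The section value depends only on the coset, and the coset of
    \<open>\<rho> x\<close> is that of \<open>\<rho> \<one>\<close>. The section values therefore
    cancel in \<open>chr\<close>, and the corner entries remain with the minus sign they carry in
    \<open>sec_corner\<close>.\<close>
  then have "lam p (Suc m) (\<rho> x) = lam p (Suc m) (\<rho> \<one>)" using lift xG by simp
  moreover have "\<rho> \<one> 1 (Suc m + 1) = 0"
    using group_hom.hom_one[OF uhomsD(4)[OF \<rho>]] by (simp add: Unip_one)
  ultimately show "chr ?h x = (- \<rho> x 1 (Suc m + 1)) mod int p"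
    by (simp add: chr_def sec_corner_def[OF p_gt_1] mod_diff_eq)
qed

text \<open>On N the values of \<open>\<rho>\<close> lie in \<open>Zc\<close>, the kernel of
  \<open>lam\<close>, so the composite with \<open>lam\<close> factors through G/N. Hence every
  \<open>\<rho>\<close> contributes a Massey class.\<close>

lemma reduction_exists:
  assumes \<rho>: "\<rho> \<in> uhoms (Suc m)"
  shows "\<exists>\<rho>b\<in>chom Gbar \<tau>bar (Ubar p (Suc m)) dUbar. \<forall>x\<in>carrier G. lam p (Suc m) (\<rho> x) = \<rho>b (N #> x)"
proof -
  have n: "1 \<le> Suc m" by simp
  interpret Zn: normal "Zc p (Suc m)" "U (Suc m)" by (rule normal_Zc[OF p_gt_1 n])
  have mem: "lam p (Suc m) (\<rho> x) \<in> carrier (Ubar p (Suc m))" if "x \<in> carrier G" for x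
    using uhomsD(1)[OF \<rho> that] by (simp add: carrier_Ubar[OF p_gt_1])
  have c: "continuous_map \<tau> dUbar (\<lambda>x. lam p (Suc m) (\<rho> x))"
    by (rule continuous_map_discrete_unop[OF uhomsD(3)[OF \<rho>]]) (use mem topspace_eq in auto)
  have inv: "lam p (Suc m) (\<rho> (u \<otimes> x)) = lam p (Suc m) (\<rho> x)" if u: "u \<in> N" and x: "x \<in> carrier G" for u x
  proof -
    have uG: "u \<in> carrier G" using u T_subset by blast
    have "\<rho> u \<in> Zc p (Suc m)"
      using uhom_central_on_N[OF \<rho> u] Unip_carrierD(1)[OF uhomsD(1)[OF \<rho> uG]] unfolding Zc_def by blast
    then have "Zc p (Suc m) #>\<^bsub>U (Suc m)\<^esub> \<rho> u = Zc p (Suc m)"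
      by (intro Zn.coset_join2 Zn.subgroup_axioms uhomsD(1)[OF \<rho> uG])
    then show ?thesis
      using Zn.coset_mult_assoc[OF Zn.subset uhomsD(1)[OF \<rho> uG] uhomsD(1)[OF \<rho> x]]
      by (simp add: lam_def uhomsD(2)[OF \<rho> uG x])
  qed
  obtain l where l: "continuous_map \<tau>bar dUbar l" "\<And>x. x \<in> carrier G \<Longrightarrow> l (N #> x) = lam p (Suc m) (\<rho> x)"
    using descend[OF c inv] by blast
  have "l \<in> hom Gbar (Ubar p (Suc m))"
  proof (rule homI)
    fix a b assume "a \<in> carrier Gbar" "b \<in> carrier Gbar"
    then obtain x y where x: "x \<in> carrier G" "a = N #> x" and y: "y \<in> carrier G" "b = N #> y"
      by (auto simp: carrier_Gbar)
    show "l a \<in> carrier (Ubar p (Suc m))" using x mem by (simp add: l(2))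
    show "l (a \<otimes>\<^bsub>Gbar\<^esub> b) = l a \<otimes>\<^bsub>Ubar p (Suc m)\<^esub> l b"
      using x y lam_mult[OF p_gt_1 n uhomsD(1)[OF \<rho> x(1)] uhomsD(1)[OF \<rho> y(1)]]
      by (simp add: Gbar_mult l(2) uhomsD(2)[OF \<rho>])
  qed
  then show ?thesis using l by (auto simp: chom_def intro!: bexI[of _ l])
qed

section \<open>Massey classes inside the kernel of inflation\<close>

definition massey_classes :: "('g set \<Rightarrow> 'g set \<Rightarrow> int) set set" where
  "massey_classes = {H2_pull Gbar \<tau>bar p \<rho>b (alpha p (Suc m)) | \<rho>b.
     \<rho>b \<in> chom Gbar \<tau>bar (Ubar p (Suc m)) dUbar
     \<and> (\<exists>\<rho>\<in>uhoms (Suc m). \<forall>x\<in>carrier G. lam p (Suc m) (\<rho> x) = \<rho>b (N #> x))}"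

lemma Massey_eq: "Massey G \<tau> p (Suc m) = generate C.H massey_classes"
  by (simp add: Massey_def massey_classes_def)

abbreviation "ker_infl \<equiv> kernel C.H CM.H (infl G \<tau> p (Suc m))"

lemma subgroup_ker_infl: "subgroup ker_infl C.H"
  by (intro group_hom.subgroup_kernel group_hom.intro group_hom_axioms.intro C.group_H2 CM.group_H2 infl_hom)

lemma ker_infl_iff: "c \<in> ker_infl \<longleftrightarrow> (\<exists>f\<in>Z2 Gbar \<tau>bar p. \<exists>h. c = C.cls f \<and> splits f h)"
  using infl_trivial_iff by (auto simp: kernel_def C.carrier_H2)

text \<open>The lift \<open>\<rho>\<close> required of a Massey class is what supplies a splitting
  of its inflated cocycle.\<close>

lemma massey_classes_subset: "massey_classes \<subseteq> ker_infl"
proof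
  fix c assume "c \<in> massey_classes"
  then obtain \<rho>b \<rho> where c: "c = H2_pull Gbar \<tau>bar p \<rho>b (alpha p (Suc m))"
    and r: "\<rho> \<in> uhoms (Suc m)" "\<rho>b \<in> chom Gbar \<tau>bar (Ubar p (Suc m)) dUbar"
      "\<And>x. x \<in> carrier G \<Longrightarrow> lam p (Suc m) (\<rho> x) = \<rho>b (N #> x)"
    unfolding massey_classes_def by blast
  obtain f h where "f \<in> Z2 Gbar \<tau>bar p" "H2_pull Gbar \<tau>bar p \<rho>b (alpha p (Suc m)) = C.cls f" "splits f h"
    by (rule H2_pull_alpha[OF r], assumption, rule that)
  with c show "c \<in> ker_infl" using ker_infl_iff by blast
qed

lemma Massey_subset: "Massey G \<tau> p (Suc m) \<subseteq> ker_infl"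
  unfolding Massey_eq
  by (rule group.generate_subgroup_incl[OF C.group_H2 massey_classes_subset subgroup_ker_infl])

lemma subgroup_Massey: "subgroup (Massey G \<tau> p (Suc m)) C.H"
  unfolding Massey_eq
  by (rule group.generate_is_subgroup[OF C.group_H2])
    (use massey_classes_subset subgroup.subset[OF subgroup_ker_infl] in blast)

section \<open>The pairing of N/M with the kernel of inflation\<close>

definition pairing :: "'g set \<Rightarrow> ('g set \<Rightarrow> 'g set \<Rightarrow> int) set \<Rightarrow> int" where
  "pairing a c = chr (SOME h. \<exists>f\<in>Z2 Gbar \<tau>bar p. c = C.cls f \<and> splits f h) (SOME x. x \<in> a)"

text \<open>Independence of the two choices in \<open>pairing\<close>: \<open>chr_M\<close> takes
  care of the point of the coset, \<open>chr_unique\<close> of the splitting and of the cocycle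
  within its class.\<close>

lemma pairing_eq:
  assumes f: "f \<in> Z2 Gbar \<tau>bar p" and h: "splits f h" and x: "x \<in> N"
  shows "pairing (M #> x) (C.cls f) = chr h x"
proof -
  have xG: "x \<in> carrier G" using x T_subset by blast
  have "\<exists>k. \<exists>g\<in>Z2 Gbar \<tau>bar p. C.cls f = C.cls g \<and> splits g k" using f h by blast
  then have "\<exists>g\<in>Z2 Gbar \<tau>bar p. C.cls f = C.cls g
      \<and> splits g (SOME k. \<exists>g\<in>Z2 Gbar \<tau>bar p. C.cls f = C.cls g \<and> splits g k)"
    by (rule someI_ex)
  then obtain g k where g: "g \<in> Z2 Gbar \<tau>bar p" "C.cls f = C.cls g" "splits g k"
    and k: "k = (SOME k. \<exists>g\<in>Z2 Gbar \<tau>bar p. C.cls f = C.cls g \<and> splits g k)" by blast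
  have "pairing (M #> x) (C.cls f) = chr k (SOME y. y \<in> M #> x)" by (simp add: pairing_def k)
  also have "\<dots> = chr k x" by (rule coset_representative[OF chr_M[OF g(3)] xG])
  also have "\<dots> = chr h x" using chr_unique[OF f g(2) h g(3) x] by simp
  finally show ?thesis .
qed

abbreviation "A \<equiv> Tquot G \<tau> p (Suc m)"
abbreviation "Ker \<equiv> C.H\<lparr>carrier := ker_infl\<rparr>"

lemma normal_M_N: "M \<lhd> G\<lparr>carrier := N\<rparr>"
  by (rule normal_restrict_supergroup[OF NG.subgroup_axioms normal_T M_subset_N])

lemma r_coset_N: "M #>\<^bsub>G\<lparr>carrier := N\<rparr>\<^esub> x = M #> x"
  by (simp add: r_coset_def)

lemma carrier_A: "carrier A = (\<lambda>x. M #> x) ` N"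
  by (simp add: Tquot_def carrier_FactGroup r_coset_N)

lemma mult_A: "x \<in> N \<Longrightarrow> y \<in> N \<Longrightarrow> (M #> x) \<otimes>\<^bsub>A\<^esub> (M #> y) = M #> (x \<otimes> y)"
  using normal.rcos_sum[OF normal_M_N, of x y] by (simp add: Tquot_def r_coset_N)

lemma one_A: "\<one>\<^bsub>A\<^esub> = M"
  by (simp add: Tquot_def)

text \<open>Nondegeneracy on the side of the kernel is \<open>cls_eq_if_chr_eq\<close>. Separation
  of the points of N/M is left aside here, because it is to be proved with Massey classes
  alone.\<close>

lemma compact_pairing: "compact_pairing A Ker p pairing (\<tau>Tquot G \<tau> p (Suc m))"
proof -
  have tN: "topspace (subtopology \<tau> N) = N" using T_subset topspace_eq by auto
  show ?thesis
  proof (intro compact_pairing.intro mod_pairing.intro mod_pairing_axioms.intro compact_pairing_axioms.intro)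
    show "group A" unfolding Tquot_def using normal.factorgroup_is_group[OF normal_M_N] by simp
    show "group Ker" by (rule group.subgroup_imp_group[OF C.group_H2 subgroup_ker_infl])
    show "Factorial_Ring.prime p" by (rule prime_p)
  next
    fix a a' c assume "a \<in> carrier A" "a' \<in> carrier A" "c \<in> carrier Ker"
    then obtain x y f h where x: "x \<in> N" "a = M #> x" and y: "y \<in> N" "a' = M #> y"
      and f: "f \<in> Z2 Gbar \<tau>bar p" "c = C.cls f" "splits f h"
      using ker_infl_iff by (auto simp: carrier_A)
    have "y \<in> carrier G" "x \<otimes> y \<in> N" using x y T_subset NG.m_closed by auto
    then show "[pairing (a \<otimes>\<^bsub>A\<^esub> a') c = pairing a c + pairing a' c] (mod int p)"
      using chr_mult[OF f(3) x(1)] x y f by (simp add: mult_A pairing_eq)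
  next
    fix a c d assume "a \<in> carrier A" "c \<in> carrier Ker" "d \<in> carrier Ker"
    then obtain x f h g k where x: "x \<in> N" "a = M #> x" 
      and f: "f \<in> Z2 Gbar \<tau>bar p" "c = C.cls f" "splits f h"
      and g: "g \<in> Z2 Gbar \<tau>bar p" "d = C.cls g" "splits g k"
      using ker_infl_iff by (auto simp: carrier_A)
    then show "[pairing a (c \<otimes>\<^bsub>Ker\<^esub> d) = pairing a c + pairing a d] (mod int p)"
      using pairing_eq[OF C.Z2_add[OF f(1) g(1)] splits_add[OF f(3) g(3)] x(1)] chr_add[of h k x]
      by (simp add: C.mult_cls pairing_eq)
  next
    have "compact_space (subtopology \<tau> N)"
      using profinite closedin_T by (simp add: profinite_group_def compact_space_subtopology closedin_compact_space)
    then show "compact_space (\<tau>Tquot G \<tau> p (Suc m))" by (simp add: \<tau>Tquot_def compact_space_qtop)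
    show "topspace (\<tau>Tquot G \<tau> p (Suc m)) = carrier A"
      using tN by (simp add: \<tau>Tquot_def topspace_qtop carrier_A)
  next
    fix c assume "c \<in> carrier Ker"
    then obtain f h where f: "f \<in> Z2 Gbar \<tau>bar p" "c = C.cls f" "splits f h"
      using ker_infl_iff by auto
    show "continuous_map (\<tau>Tquot G \<tau> p (Suc m)) values (\<lambda>a. pairing a c)"
      unfolding \<tau>Tquot_def diff_Suc_1
      by (rule continuous_map_from_qtop[OF continuous_map_from_subtopology[OF chr_continuous[OF f(3)]]])
        (use tN f in \<open>simp add: pairing_eq\<close>)
  next
    fix c d assume "c \<in> carrier Ker" "d \<in> carrier Ker" and eq: "\<And>a. a \<in> carrier A \<Longrightarrow> pairing a c = pairing a d"
    then obtain f h g k where f: "f \<in> Z2 Gbar \<tau>bar p" "c = C.cls f" "splits f h"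
      and g: "g \<in> Z2 Gbar \<tau>bar p" "d = C.cls g" "splits g k"
      using ker_infl_iff by auto
    have "chr h x = chr k x" if "x \<in> N" for x
      using eq[of "M #> x"] that f g by (simp add: carrier_A pairing_eq)
    then show "c = d" using cls_eq_if_chr_eq[OF f(1) g(1) f(3) g(3)] f g by simp
  qed
qed

text \<open>The generators suffice: the class obtained from \<open>\<rho>\<close> pairs with
  \<open>x\<close> to minus the corner of \<open>\<rho> x\<close>, the only entry that is still free
  for \<open>x\<close> in N. If all these corners vanish, every \<open>\<rho>\<close> kills
  \<open>x\<close>.\<close>

lemma Massey_separates:
  assumes a: "a \<in> carrier A" and zero: "\<And>c. c \<in> Massey G \<tau> p (Suc m) \<Longrightarrow> pairing a c = 0"
  shows "a = \<one>\<^bsub>A\<^esub>"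
proof -
  obtain x where x: "x \<in> N" "a = M #> x" using a by (auto simp: carrier_A)
  then have xG: "x \<in> carrier G" using T_subset by blast
  have "x \<in> M"
    unfolding T_iff
  proof (intro conjI ballI xG)
    fix \<rho> assume \<rho>: "\<rho> \<in> uhoms (Suc m)"
    obtain \<rho>b where \<rho>b: "\<rho>b \<in> chom Gbar \<tau>bar (Ubar p (Suc m)) dUbar"
      "\<And>x. x \<in> carrier G \<Longrightarrow> lam p (Suc m) (\<rho> x) = \<rho>b (N #> x)"
      using reduction_exists[OF \<rho>] by blast
    let ?c = "H2_pull Gbar \<tau>bar p \<rho>b (alpha p (Suc m))"
    have "?c \<in> massey_classes" unfolding massey_classes_def using \<rho> \<rho>b by blast
    then have "?c \<in> Massey G \<tau> p (Suc m)" unfolding Massey_eq by (rule generate.incl)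
    then have "pairing a ?c = 0" by (rule zero)
    moreover obtain f h where f: "f \<in> Z2 Gbar \<tau>bar p" "?c = C.cls f" "splits f h"
      "\<And>x. x \<in> N \<Longrightarrow> chr h x = (- \<rho> x 1 (Suc m + 1)) mod int p"
      using H2_pull_alpha[OF \<rho> \<rho>b] by metis
    ultimately have "(- \<rho> x 1 (Suc m + 1)) mod int p = 0"
      using x by (simp add: pairing_eq)
    then have "[\<rho> x 1 (Suc m + 1) = 0] (mod int p)" by (simp add: cong_0_iff mod_eq_0_iff_dvd)
    then have "\<rho> x 1 (Suc m + 1) = 0"
      by (rule cong_0_reduced) (rule Unip_carrierD(1)[OF uhomsD(1)[OF \<rho> xG]])
    then show "\<rho> x = \<one>\<^bsub>U (Suc m)\<^esub>"
      using uhom_central_on_N[OF \<rho> x(1)] Zemb_0[OF p_gt_1] by simp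
  qed
  then show ?thesis using x xG coset_join2[OF xG MG.subgroup_axioms] by (simp add: one_A)
qed

lemma ker_infl_eq_Massey: "ker_infl = Massey G \<tau> p (Suc m)"
proof -
  interpret CP: compact_pairing A Ker p pairing "\<tau>Tquot G \<tau> p (Suc m)" by (rule compact_pairing)
  have "Massey G \<tau> p (Suc m) = carrier Ker"
    by (rule CP.separating_subset_eq)
      (use Massey_subset subgroup.one_closed[OF subgroup_Massey] subgroup.m_closed[OF subgroup_Massey]
        Massey_separates in auto)
  then show ?thesis by simp
qed

lemma perfect_pairing_Massey:
  "perfect_pairing A (\<tau>Tquot G \<tau> p (Suc m)) (C.H\<lparr>carrier := Massey G \<tau> p (Suc m)\<rparr>) p pairing"
proof -
  interpret CP: compact_pairing A Ker p pairing "\<tau>Tquot G \<tau> p (Suc m)" by (rule compact_pairing)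
  have "perfect_pairing A (\<tau>Tquot G \<tau> p (Suc m)) Ker p pairing"
    by (rule CP.perfect_pairing) (use Massey_separates in \<open>simp add: ker_infl_eq_Massey\<close>)
  then show ?thesis by (simp add: ker_infl_eq_Massey)
qed

end

theorem theorem9p1:
  fixes G :: "('g, 'b) monoid_scheme" and \<tau> :: "'g topology" and p n :: nat
  assumes "Factorial_Ring.prime p" and "n \<ge> 2" and "profinite_group G \<tau>"
  shows "(\<exists>B. perfect_pairing (Tquot G \<tau> p n) (\<tau>Tquot G \<tau> p n)
                 ((H2 (Gq G \<tau> p (n-1)) (\<tau>q G \<tau> p (n-1)) p)\<lparr>carrier := Massey G \<tau> p n\<rparr>) p B)
       \<and> subgroup (Massey G \<tau> p n) (H2 (Gq G \<tau> p (n-1)) (\<tau>q G \<tau> p (n-1)) p)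
       \<and> infl G \<tau> p n \<in> hom (H2 (Gq G \<tau> p (n-1)) (\<tau>q G \<tau> p (n-1)) p) (H2 (Gq G \<tau> p n) (\<tau>q G \<tau> p n) p)
       \<and> kernel (H2 (Gq G \<tau> p (n-1)) (\<tau>q G \<tau> p (n-1)) p) (H2 (Gq G \<tau> p n) (\<tau>q G \<tau> p n) p)
                (infl G \<tau> p n) = Massey G \<tau> p n"
proof -
  obtain m where n: "n = Suc m" and "1 \<le> m" using assms(2) by (cases n) auto
  with assms interpret massey G \<tau> p m by unfold_locales
  show ?thesis
    unfolding n diff_Suc_1
    using perfect_pairing_Massey subgroup_Massey infl_hom ker_infl_eq_Massey by blast
qed

end
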